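(* Let $0<d<\pi/2$, $\mathscr{D}_d=\{\zeta\in\mathbb{C}:|\Im\zeta|<d\}$, $\mathscr{D}_d^{-}=\{\zeta\in\mathscr{D}_d:\Re\zeta<0\}$, $\mathscr{D}_d^{+}=\{\zeta\in\mathscr{D}_d:\Re\zeta\ge0\}$, and $\psi(t)=\sinh t$. Assume $f$ is analytic on $\psi(\mathscr{D}_d)$ and there are constants $K,\alpha,\beta>0$ with $|f(z)|\le K|1+z^2|^{-(\alpha+1)/2}$ for $z\in\psi(\mathscr{D}_d^-)$ and $|f(z)|\le K|1+z^2|^{-(\beta+1)/2}$ for $z\in\psi(\mathscr{D}_d^+)$. Let $\mu=\min\{\alpha,\beta\}$, $\nu=\max\{\alpha,\beta\}$, let $n$ be a positive integer, $h=\sqrt{\pi d/(\mu n)}$, and let $M=n$, $N=\lceil\alpha n/\beta\rceil$ if $\mu=\alpha$, and $N=n$, $M=\lceil\beta n/\alpha\rceil$ if $\mu=\beta$. Then \[ \sup_{\tau\in\mathbb{R}}\left|\int_{-\infty}^{\tau}f(t)\,dt-\sum_{k=-M}^{N}f(\psi(kh))\psi'(kh)J(k,h)(\psi^{-1}(\tau))\right|\le C_1e^{-\sqrt{\pi d\mu n}}, \] with $C_1=\frac{2^{\nu+1}K}{\mu}\left\{\frac{1}{(1-e^{-2\sqrt{\pi d\mu}})(\cos d)^{\nu}}\sqrt{\frac{\pi}{d\mu}}+1.1\right\}$.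
   Context: $J(k,h)(x)=h\left\{\frac12+\frac1\pi\operatorname{Si}[\pi(x/h-k)]\right\}$, where $\operatorname{Si}(x)=\int_0^x\frac{\sin\sigma}{\sigma}\,d\sigma$. $\psi^{-1}=\operatorname{arcsinh}$. *)

theory Defs
  imports "HOL-Probability.Sinc_Integral"
begin

definition strip :: "real \<Rightarrow> complex set" where
  "strip d = {\<zeta>. \<bar>Im \<zeta>\<bar> < d}"

definition Jfun :: "int \<Rightarrow> real \<Rightarrow> real \<Rightarrow> real" where
  "Jfun k h x = h * (1/2 + Si (pi * (x / h - real_of_int k)) / pi)"

end

theory Submission
  imports Defs "HOL-Complex_Analysis.Complex_Analysis" "HOL-Real_Asymp.Real_Asymp"
begin

text \<open>
  Put \<open>g z = f (sinh z) * cosh z\<close>; on the strip it decays like \<open>G * exp (- \<mu> * \<bar>Re z\<bar>)\<close>. The residue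
  theorem for \<open>g z / (sin (pi * z / h) * (z - t))\<close> on the rectangle with half-width \<open>(m + 1/2) * h\<close>
  and half-height \<open>d' < d\<close> represents the sinc interpolation error at \<open>t\<close> as a contour integral.
  Integrating over \<open>t\<close> and exchanging the integrals produces the kernel
  \<open>\<Phi> z = \<integral> sin (pi * t / h) / (z - t) dt\<close>, which is at most \<open>h / \<bar>Im z\<bar>\<close> by integration by parts; since
  \<open>sin (pi * z / h)\<close> is at least \<open>sinh (pi * d' / h)\<close> on the horizontal sides, letting \<open>m\<close> tend to
  infinity and \<open>d'\<close> to \<open>d\<close> gives the discretization error. The truncation error is a geometric tail,
  multiplied by the bound \<open>11/10 * h\<close> on the basis functions, which comes from \<open>Si \<le> Si pi < 1.87\<close>.
\<close>

section \<open>The sine integral and the indefinite sinc functions\<close>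

text \<open>The exchange of integrals is what makes the bound uniform in the upper limit. An
  absolute estimate under the integral would not do: the integral of
  \<open>1 / \<bar>z - t\<bar>\<close> over \<open>t\<close> grows logarithmically with the length
  of the interval, whereas the oscillation of \<open>sin (pi * t / h)\<close> keeps the kernel
  bounded. This bound degenerates where \<open>Im z = 0\<close>, that is, where the vertical sides
  cross the real axis. There the interval of integration has to keep its distance from the sides, so
  the lower limit \<open>-\<infinity>\<close> is first replaced by a cut-off that moves with the
  rectangle. Since \<open>g\<close> is controlled only on the open strip, the contour has
  half-height \<open>d' < d\<close>, and \<open>d\<close> itself is reached by continuity of the
  final bound.\<close>

lemma Si_pi_le: "Si pi \<le> 187/100"
proof -
  \<comment> \<open>the integrated Taylor polynomial of sinc, with its remainder bound\<close>
  define P :: "real \<Rightarrow> real" where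
    "P = (\<lambda>x. x - x^3/18 + x^5/600 - x^7/35280 + x^9/3265920 + x^11/439084800)"
  have *: "Si pi - P pi \<le> Si 0 - P 0"
  proof (rule DERIV_nonpos_imp_nonincreasing[where f = "\<lambda>x. Si x - P x"])
    fix x :: real assume x: "0 \<le> x" "x \<le> pi"
    let ?q = "1 - x^2/6 + x^4/120 - x^6/5040 + x^8/362880 + x^10/39916800"
    have der: "((\<lambda>x. Si x - P x) has_real_derivative sinc x - ?q) (at x)"
      unfolding P_def by (auto intro!: derivative_eq_intros DERIV_Si simp: field_simps)
    have "sinc x \<le> ?q"
    proof (cases "x = 0")
      case False
      have "sin x - (\<Sum>m<11. sin_coeff m * x ^ m) \<le> inverse (fact 11) * \<bar>x\<bar> ^ 11"
        using Maclaurin_sin_bound[of x 11] by linarith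
      also have "(\<Sum>m<11. sin_coeff m * x ^ m) = x - x^3/6 + x^5/120 - x^7/5040 + x^9/362880"
        by (simp add: sin_coeff_def lessThan_nat_numeral fact_numeral)
      finally have "sin x \<le> x * ?q"
        using x by (simp add: fact_numeral field_simps eval_nat_numeral)
      thus ?thesis using False x by (simp add: divide_le_eq mult.commute)
    qed auto
    thus "\<exists>y. ((\<lambda>x. Si x - P x) has_real_derivative y) (at x) \<and> y \<le> 0"
      using der by auto
  qed auto
  have "Si 0 = 0" using Si_neg[of 0] by simp
  hence "Si pi \<le> P pi" using * by (simp add: P_def)
  \<comment> \<open>\<open>Si pi\<close> is about 1.852, and later only
    \<open>187/100 / pi \<le> 6/10\<close> is needed, so four decimals of \<open>pi\<close> suffice:
    the upper one for the positive monomials, the lower one for the negative ones.\<close>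
  also have "P pi \<le> 187/100"
  proof -
    have u: "pi ^ k \<le> (3.1416::real)^k" for k 
      using pi_approx by (intro power_mono) auto
    have l: "(3.1415::real)^k \<le> pi ^ k" for k 
      using pi_approx by (intro power_mono) auto
    show ?thesis unfolding P_def using u[of 1] l[of 3] u[of 5] l[of 7] u[of 9] u[of 11]
      by (simp add: power_divide)
  qed
  finally show ?thesis .
qed

text \<open>The maximum lies at \<open>pi\<close>, where \<open>sinc\<close> first changes sign.
  Oddness reduces the claim to arguments \<open>v \<ge> 0\<close>; there the upper bound has to be
  good, while the crude lower bound -1 is enough.\<close>

lemma Si_bound: "\<bar>Si u\<bar> \<le> 187/100"
proof -
  have Si_0: "Si 0 = 0" using Si_neg[of 0] by simp
  have mono: "Si a \<le> Si b" if "0 \<le> a" "a \<le> b" "b \<le> pi" for a b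
  proof (rule DERIV_nonneg_imp_nondecreasing[OF that(2)])
    fix x assume "a \<le> x" "x \<le> b"
    thus "\<exists>y. (Si has_real_derivative y) (at x) \<and> 0 \<le> y"
      using that by (intro exI[of _ "sinc x"] conjI DERIV_Si) (auto intro!: divide_nonneg_nonneg sin_ge_zero)
  qed
  have nonneg: "Si v \<le> 187/100 \<and> -1 \<le> Si v" if v: "v \<ge> 0" for v
  proof (cases "v \<le> pi")
    case True
    show ?thesis using mono[of 0 v] mono[of v pi] Si_pi_le True v Si_0 by auto
  next
    case False
    have pos: "v > pi" using False by auto
    \<comment> \<open>beyond \<open>pi\<close>, adding \<open>(cos v \<plusminus> 1) / v\<close> to \<open>Si v\<close> makes it monotone\<close>
    have "Si v + (cos v + 1) / v \<le> Si pi + (cos pi + 1) / pi"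
    proof (rule DERIV_nonpos_imp_nonincreasing[where f = "\<lambda>x. Si x + (cos x + 1) / x"])
      fix x assume x: "pi \<le> x" "x \<le> v"
      hence x0: "x > 0" using pi_gt_zero by linarith
      have "((\<lambda>x. Si x + (cos x + 1) / x) has_real_derivative - (cos x + 1) / x\<^sup>2) (at x)"
        using x0 by (auto intro!: derivative_eq_intros DERIV_Si simp: field_simps power2_eq_square)
      moreover have "- (cos x + 1) / x\<^sup>2 \<le> 0" using cos_ge_minus_one[of x]
        by (intro divide_nonpos_nonneg) auto
      ultimately show "\<exists>y. ((\<lambda>x. Si x + (cos x + 1) / x) has_real_derivative y) (at x) \<and> y \<le> 0"
        by blast
    qed (use pos in auto)
    moreover have "(cos v + 1) / v \<ge> 0" using pos pi_gt_zero cos_ge_minus_one[of v]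
      by (intro divide_nonneg_nonneg) linarith+
    ultimately have up: "Si v \<le> 187/100" using Si_pi_le by simp
    have "Si v + (cos v - 1) / v \<ge> Si pi + (cos pi - 1) / pi"
    proof (rule DERIV_nonneg_imp_nondecreasing[where f = "\<lambda>x. Si x + (cos x - 1) / x"])
      fix x assume x: "pi \<le> x" "x \<le> v"
      hence x0: "x > 0" using pi_gt_zero by linarith
      have "((\<lambda>x. Si x + (cos x - 1) / x) has_real_derivative (1 - cos x) / x\<^sup>2) (at x)"
        using x0 by (auto intro!: derivative_eq_intros DERIV_Si simp: field_simps power2_eq_square)
      moreover have "(1 - cos x) / x\<^sup>2 \<ge> 0"
        by (intro divide_nonneg_nonneg) auto
      ultimately show "\<exists>y. ((\<lambda>x. Si x + (cos x - 1) / x) has_real_derivative y) (at x) \<and> y \<ge> 0"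
        by blast
    qed (use pos in auto)
    moreover have "(cos v - 1) / v \<le> 0" using pos pi_gt_zero
      by (intro divide_nonpos_nonneg) (auto simp del: pi_gt_zero)
    ultimately have "Si v \<ge> Si pi - 2 / pi" by simp
    moreover have "2/pi \<le> 1" using pi_gt3 by simp
    ultimately have "Si v \<ge> Si pi - 1" by linarith
    with up mono[of 0 pi] Si_0 show ?thesis by auto
  qed
  show ?thesis using nonneg[of u] nonneg[of "-u"] Si_neg[of "-u"] by (cases "u \<ge> 0") auto
qed

text \<open>Origin of the 1.1 in \<open>C1\<close>: \<open>1/2 + 187/100 / pi\<close> is about
  1.095.\<close>

lemma abs_Jfun_le:
  assumes "h > 0"
  shows "\<bar>Jfun k h x\<bar> \<le> 11/10 * h"
proof -
  let ?s = "Si (pi * (x / h - real_of_int k))"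
  have "\<bar>?s / pi\<bar> \<le> 6/10"
    using Si_bound[of "pi * (x / h - real_of_int k)"] pi_approx by (simp add: field_simps)
  hence "\<bar>1/2 + ?s / pi\<bar> \<le> 11/10" by linarith
  thus ?thesis using assms by (simp add: Jfun_def abs_mult mult.commute)
qed

text \<open>The link to sinc interpolation: integrating an interpolant termwise turns each cardinal
  function into an increment of \<open>Jfun k h\<close>.\<close>

lemma Jfun_has_real_derivative:
  assumes "h > 0"
  shows "(Jfun k h has_real_derivative sinc (pi * (x / h - real_of_int k))) (at x)"
proof -
  have "((\<lambda>x. Si (pi * (x / h - real_of_int k))) has_real_derivative
          sinc (pi * (x / h - real_of_int k)) * (pi * (1 / h))) (at x)"
    by (rule DERIV_chain'[OF _ DERIV_Si]) (use assms in \<open>auto intro!: derivative_eq_intros\<close>)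
  from DERIV_cmult[OF DERIV_add[OF DERIV_const[of "1/2"] DERIV_cdivide[OF this, of pi]], of h] show ?thesis
    using assms unfolding Jfun_def[abs_def] by simp
qed

text \<open>The summand \<open>1/2\<close> is the normalization responsible for this, since
  \<open>Si / pi\<close> tends to \<open>-1/2\<close> on the left. Oddness of \<open>Si\<close>
  reflects the claim to its known limit \<open>pi / 2\<close> on the right.\<close>

lemma Jfun_at_bot:
  assumes "h > 0"
  shows "(Jfun k h \<longlongrightarrow> 0) at_bot"
proof -
  have "filterlim (\<lambda>x. pi * real_of_int k + (pi / h) * x) at_top at_top"
    using assms by real_asymp
  hence "((\<lambda>x. Si (pi * real_of_int k + (pi / h) * x)) \<longlongrightarrow> pi / 2) at_top"
    by (rule filterlim_compose[OF Si_at_top])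
  hence "((\<lambda>x. h * (1/2 - Si (pi * real_of_int k + (pi / h) * x) / pi)) \<longlongrightarrow> h * (1/2 - (pi/2)/pi)) at_top"
    by (intro tendsto_intros) auto
  hence "((\<lambda>x. Jfun k h (-x)) \<longlongrightarrow> 0) at_top"
  proof (rule tendsto_cong[THEN iffD1, THEN tendsto_eq_rhs, rotated])
    show "eventually (\<lambda>x. h * (1/2 - Si (pi * real_of_int k + (pi / h) * x) / pi) = Jfun k h (-x)) at_top"
      using eventually_ge_at_top[of "- h * real_of_int k"]
    proof eventually_elim
      case (elim x)
      have "pi * real_of_int k + (pi / h) * x \<ge> 0"
      proof -
        have "h * real_of_int k + x \<ge> 0" using elim by simp
        hence "pi / h * (h * real_of_int k + x) \<ge> 0" using assms by (intro mult_nonneg_nonneg) auto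
        thus ?thesis using assms by (simp add: field_simps)
      qed
      moreover have "pi * (- x / h - real_of_int k) = - (pi * real_of_int k + (pi / h) * x)"
        by (simp add: algebra_simps)
      ultimately have eq: "Si (pi * (- x / h - real_of_int k)) = - Si (pi * real_of_int k + (pi / h) * x)"
        by (metis Si_neg)
      show ?case unfolding Jfun_def eq by simp
    qed
  qed auto
  thus ?thesis by (simp add: filterlim_at_bot_mirror)
qed

section \<open>The oscillatory kernel\<close>

text \<open>With \<open>v = tan \<theta>\<close> the distance is
  \<open>\<bar>Im z\<bar> / cos \<theta>\<close>, and \<open>cos \<theta>\<close> is the sine of
  \<open>pi / 2 - \<bar>\<theta>\<bar>\<close>, hence at most that angle. The right-hand side is the
  integral of \<open>1 / \<bar>z - s\<bar>\<^sup>2\<close> over the real half-line that starts at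
  \<open>t\<close> and leads away from \<open>Re z\<close>.\<close>

lemma inverse_dist_le_arctan:
  fixes z :: complex
  assumes "Im z \<noteq> 0"
  shows "1 / norm (z - of_real t) \<le> (pi / 2 - \<bar>arctan ((t - Re z) / \<bar>Im z\<bar>)\<bar>) / \<bar>Im z\<bar>"
proof -
  define v where "v = (t - Re z) / \<bar>Im z\<bar>"
  have "norm (z - of_real t) = sqrt ((t - Re z)\<^sup>2 + (Im z)\<^sup>2)"
    by (simp add: cmod_def power2_commute)
  also have "(t - Re z)\<^sup>2 + (Im z)\<^sup>2 = (Im z)\<^sup>2 * (1 + v\<^sup>2)"
    using assms by (simp add: v_def field_simps)
  also have "sqrt \<dots> = \<bar>Im z\<bar> * sqrt (1 + v\<^sup>2)" by (simp add: real_sqrt_mult)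
  finally have "1 / norm (z - of_real t) = cos (arctan v) / \<bar>Im z\<bar>"
    by (simp add: cos_arctan)
  also have "cos (arctan v) = sin (pi / 2 - \<bar>arctan v\<bar>)"
    by (simp add: sin_diff abs_if)
  also have "\<dots> \<le> pi / 2 - \<bar>arctan v\<bar>"
    using arctan_bounded[of v] by (intro sin_x_le_x) (auto simp: abs_if)
  finally show ?thesis unfolding v_def by (simp add: divide_right_mono)
qed

text \<open>
  Bounding both boundary terms of the integration by parts by \<open>1 / (w * \<bar>Im z\<bar>)\<close> would give \<open>pi + 2\<close>, too
  large for \<open>C1\<close>. Instead, each of them is at most a missing tail of \<open>\<integral> dt / (w * \<bar>z - t\<bar>\<^sup>2)\<close>.
\<close>

lemma norm_integral_sin_over_linear_le:
  fixes z :: complex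
  assumes "Im z \<noteq> 0" "w > 0" "a \<le> b"
  shows "norm (integral {a..b} (\<lambda>t. of_real (sin (w * t)) / (z - of_real t))) \<le> pi / (w * \<bar>Im z\<bar>)"
proof -
  define y where "y = \<bar>Im z\<bar>"
  have y: "y > 0" using assms by (simp add: y_def)
  have nz: "z - of_real t \<noteq> 0" for t using assms(1) by (auto simp: complex_eq_iff)
  \<comment> \<open>Boundary term \<open>F\<close> and remaining integrand \<open>q\<close> of the
    integration by parts that integrates the sine and differentiates
    \<open>1 / (z - t)\<close>.\<close>
  define F where "F = (\<lambda>t. - of_real (cos (w * t)) / (of_real w * (z - of_real t)))"
  define q where "q = (\<lambda>t. of_real (cos (w * t)) / (of_real w * (z - of_real t)\<^sup>2))"
  define A where "A = (\<lambda>t. arctan ((t - Re z) / y))"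
  have contq: "continuous_on {a..b} q"
    unfolding q_def using nz assms by (intro continuous_intros) auto
  have conts: "continuous_on {a..b} (\<lambda>t. of_real (sin (w * t)) / (z - of_real t))"
    using nz by (intro continuous_intros) auto
  have "((\<lambda>t. of_real (sin (w * t)) / (z - of_real t) - q t) has_integral F b - F a) {a..b}"
  proof (rule fundamental_theorem_of_calculus[OF assms(3)])
    fix t assume "t \<in> {a..b}"
    have "((\<lambda>u. - cos (of_real w * u) / (of_real w * (z - u))) has_field_derivative
            sin (of_real w * of_real t) / (z - of_real t) - cos (of_real w * of_real t) / (of_real w * (z - of_real t)\<^sup>2))
            (at (of_real t))"
      using nz[of t] assms(2)
      by (auto intro!: derivative_eq_intros simp: divide_simps power2_eq_square) (auto simp: algebra_simps)
    from has_vector_derivative_real_field[OF this, of "{a..b}"]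
    show "(F has_vector_derivative of_real (sin (w * t)) / (z - of_real t) - q t) (at t within {a..b})"
      by (simp add: F_def q_def flip: cos_of_real sin_of_real of_real_mult)
  qed
  hence eq: "integral {a..b} (\<lambda>t. of_real (sin (w * t)) / (z - of_real t)) - integral {a..b} q = F b - F a"
    by (subst integral_diff[symmetric]) (auto intro!: integrable_continuous_interval contq conts simp: integral_unique)
  have Aint: "((\<lambda>t. 1 / (w * ((t - Re z)\<^sup>2 + y\<^sup>2))) has_integral A b / (w * y) - A a / (w * y)) {a..b}"
  proof (rule fundamental_theorem_of_calculus[OF assms(3)])
    fix t assume "t \<in> {a..b}"
    have "((\<lambda>t. A t / (w * y)) has_real_derivative 1 / (w * ((t - Re z)\<^sup>2 + y\<^sup>2))) (at t within {a..b})"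
      unfolding A_def using y assms
      by (auto intro!: derivative_eq_intros simp: divide_simps power2_eq_square)
    thus "((\<lambda>t. A t / (w * y)) has_vector_derivative 1 / (w * ((t - Re z)\<^sup>2 + y\<^sup>2))) (at t within {a..b})"
      by (simp add: has_real_derivative_iff_has_vector_derivative)
  qed
  have "norm (integral {a..b} q) \<le> integral {a..b} (\<lambda>t. 1 / (w * ((t - Re z)\<^sup>2 + y\<^sup>2)))"
  proof (rule integral_norm_bound_integral)
    fix t
    have "norm (q t) = \<bar>cos (w * t)\<bar> / (w * (norm (z - of_real t))\<^sup>2)"
      using assms by (simp add: q_def norm_divide norm_mult norm_power)
    also have "(norm (z - of_real t))\<^sup>2 = (t - Re z)\<^sup>2 + y\<^sup>2"
      by (simp add: cmod_power2 y_def power2_commute)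
    also have "\<bar>cos (w * t)\<bar> / (w * ((t - Re z)\<^sup>2 + y\<^sup>2)) \<le> 1 / (w * ((t - Re z)\<^sup>2 + y\<^sup>2))"
      using assms y by (intro divide_right_mono) auto
    finally show "norm (q t) \<le> 1 / (w * ((t - Re z)\<^sup>2 + y\<^sup>2))" .
  qed (use contq Aint in \<open>auto intro: integrable_continuous_interval\<close>)
  also have "\<dots> = (A b - A a) / (w * y)" using Aint by (simp add: integral_unique diff_divide_distrib)
  finally have nq: "norm (integral {a..b} q) \<le> (A b - A a) / (w * y)" .
  have nF: "norm (F t) \<le> (pi / 2 - \<bar>A t\<bar>) / (w * y)" for t
  proof -
    have "norm (F t) = \<bar>cos (w * t)\<bar> / w * (1 / norm (z - of_real t))"
      using assms by (simp add: F_def norm_divide norm_mult)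
    also have "\<dots> \<le> 1 / w * ((pi / 2 - \<bar>A t\<bar>) / y)"
      unfolding A_def y_def using assms inverse_dist_le_arctan[OF assms(1), of t]
      by (intro mult_mono divide_right_mono) auto
    finally show ?thesis by simp
  qed
  have "norm (integral {a..b} (\<lambda>t. of_real (sin (w * t)) / (z - of_real t))) \<le> norm (F b) + norm (F a) + norm (integral {a..b} q)"
    using eq by (smt (verit, best) diff_add_cancel norm_triangle_ineq norm_triangle_ineq4)
  \<comment> \<open>Weakening \<open>- \<bar>A b\<bar>\<close> to \<open>- A b\<close> and
    \<open>- \<bar>A a\<bar>\<close> to \<open>A a\<close> makes the arctangents telescope: the two
    tails complete the integral over the interval to the one over the whole line, whatever
    \<open>a\<close> and \<open>b\<close> are.\<close>
  also have "\<dots> \<le> (pi / 2 - A b) / (w * y) + (pi / 2 + A a) / (w * y) + (A b - A a) / (w * y)"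
  proof (intro add_mono nq)
    show "norm (F b) \<le> (pi / 2 - A b) / (w * y)"
      using assms y by (intro order.trans[OF nF] divide_right_mono) auto
    show "norm (F a) \<le> (pi / 2 + A a) / (w * y)"
      using assms y by (intro order.trans[OF nF] divide_right_mono) auto
  qed
  also have "\<dots> = pi / (w * y)" by (simp flip: add_divide_distrib)
  finally show ?thesis by (simp add: y_def)
qed

section \<open>Sinc interpolation by residues\<close>

lemma sin_scaled_eq_0_imp_grid:
  fixes z :: complex and h :: real
  assumes "h > 0" "sin (of_real (pi / h) * z) = 0"
  obtains k :: int where "z = of_real (real_of_int k * h)"
proof -
  obtain k :: int where "of_real (pi / h) * z = of_real (real_of_int k * pi)"
    using assms(2) by (auto simp: sin_eq_0)
  hence "z = of_real (real_of_int k * h)"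
    using assms(1) by (simp add: field_simps)
  thus ?thesis using that by blast
qed

text \<open>The sine has a simple zero at the grid point, with the nonzero derivative
  \<open>pi / h * cos (pi * k)\<close>. The last hypothesis keeps all other grid points out of
  \<open>S\<close>.\<close>

lemma residue_over_scaled_sin:
  fixes q :: "complex \<Rightarrow> complex" and h :: real and k :: int
  assumes "h > 0" "open S" "of_real (real_of_int k * h) \<in> S" "q holomorphic_on S"
    and S: "\<And>j::int. of_real (real_of_int j * h) \<in> S \<Longrightarrow> j = k"
  shows "residue (\<lambda>z. q z / sin (of_real (pi / h) * z)) (of_real (real_of_int k * h))
           = q (of_real (real_of_int k * h)) / (of_real (pi / h) * of_real (cos (pi * real_of_int k)))"
proof (rule residue_simple'[OF assms(2,3)])
  let ?p = "complex_of_real (real_of_int k * h)" and ?w = "complex_of_real (pi / h)"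
  have wp: "?w * ?p = of_real (pi * real_of_int k)" using assms(1) by simp
  have nz: "sin (?w * z) \<noteq> 0" if "z \<in> S - {?p}" for z
    using sin_scaled_eq_0_imp_grid[OF assms(1), of z] S that by (metis DiffE singletonI)
  show "(\<lambda>z. q z / sin (?w * z)) holomorphic_on (S - {?p})"
    using nz by (intro holomorphic_intros holomorphic_on_subset[OF assms(4)]) auto
  have "((\<lambda>z. sin (?w * z)) has_field_derivative ?w * cos (?w * ?p)) (at ?p)"
    by (auto intro!: derivative_eq_intros)
  hence "((\<lambda>z. (sin (?w * z) - sin (?w * ?p)) / (z - ?p)) \<longlongrightarrow> ?w * cos (?w * ?p)) (at ?p)"
    by (simp add: has_field_derivative_iff)
  moreover have s0: "sin (?w * ?p) = 0" unfolding wp sin_of_real by simp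
  moreover have c: "cos (?w * ?p) = of_real (cos (pi * real_of_int k))" unfolding wp cos_of_real ..
  ultimately have lim: "((\<lambda>z. sin (?w * z) / (z - ?p)) \<longlongrightarrow> ?w * of_real (cos (pi * real_of_int k))) (at ?p)"
    by simp
  have "(q \<longlongrightarrow> q ?p) (at ?p)"
    using assms(2-4) by (meson continuous_on_eq_continuous_at continuous_within holomorphic_on_imp_continuous_on)
  moreover have "?w * of_real (cos (pi * real_of_int k)) \<noteq> 0"
    using assms(1) by (simp add: cos_npi_int)
  ultimately have "((\<lambda>z. q z / (sin (?w * z) / (z - ?p))) \<longlongrightarrow> q ?p / (?w * of_real (cos (pi * real_of_int k)))) (at ?p)"
    by (intro tendsto_divide lim)
  thus "((\<lambda>z. q z / sin (?w * z) * (z - ?p)) \<longlongrightarrow> q ?p / (?w * of_real (cos (pi * real_of_int k)))) (at ?p)"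
    by simp
qed

text \<open>The factor \<open>sin (pi / h * t)\<close> clears the denominator of the residue at
  \<open>t\<close>, leaving \<open>g\<close> at \<open>t\<close>, and turns the residue at each grid
  point into minus the value of \<open>g\<close> there times a shifted sinc. With \<open>t\<close>
  off the grid no two of the poles coincide.\<close>

lemma sinc_interpolation_contour:
  fixes g :: "complex \<Rightarrow> complex" and d d' h t :: real and m :: nat
  assumes holo: "g holomorphic_on strip d" and d: "0 < d'" "d' < d" and h: "h > 0"
    and t: "\<bar>t\<bar> < (real m + 1/2) * h" and grid: "\<And>k::int. t \<noteq> real_of_int k * h"
  shows "contour_integral (rectpath (Complex (- ((real m + 1/2) * h)) (-d')) (Complex ((real m + 1/2) * h) d'))
           (\<lambda>z. g z / sin (of_real (pi / h) * z) / (z - of_real t)) * of_real (sin (pi / h * t))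
         = 2 * pi * \<i> * (g (of_real t) - (\<Sum>k\<in>{-int m..int m}. g (of_real (real_of_int k * h))
             * of_real (sinc (pi * (t / h - real_of_int k)))))"
proof -
  define R where "R = (real m + 1/2) * h"
  define w where "w = pi / h"
  let ?p = "\<lambda>k::int. complex_of_real (real_of_int k * h)"
  define P where "P = ?p ` {-int m..int m}"
  define pts where "pts = insert (of_real t) P"
  \<comment> \<open>The half-width \<open>(m + 1) * h\<close> is the largest that works: the open
    box contains the closed rectangle, but of the grid points only those with index between
    \<open>-m\<close> and \<open>m\<close>.\<close>
  define S where "S = box (Complex (- ((real m + 1) * h)) (-d)) (Complex ((real m + 1) * h) d)"
  define F where "F = (\<lambda>z. g z / sin (of_real w * z) / (z - of_real t))"
  have w: "w > 0" using h by (simp add: w_def)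
  have S_strip: "S \<subseteq> strip d" by (auto simp: S_def strip_def in_box_complex_iff)
  have grid_S: "?p k \<in> S \<longleftrightarrow> k \<in> {-int m..int m}" for k
  proof -
    have "?p k \<in> S \<longleftrightarrow> real_of_int k * h < (real m + 1) * h \<and> - (real m + 1) * h < real_of_int k * h"
      using d by (auto simp: S_def in_box_complex_iff algebra_simps)
    also have "\<dots> \<longleftrightarrow> real_of_int k < real m + 1 \<and> - (real m + 1) < real_of_int k"
      using h by (simp only: mult_less_cancel_right_pos)
    also have "\<dots> \<longleftrightarrow> k \<in> {-int m..int m}" by auto
    finally show ?thesis .
  qed
  have tP: "of_real t \<notin> P" using grid by (auto simp: P_def simp del: of_real_mult)
  have injp: "inj_on ?p A" for A using h by (auto simp: inj_on_def)
  have finP: "finite P" by (simp add: P_def)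
  have tbox: "complex_of_real t \<in> box (Complex (-R) (-d')) (Complex R d')"
    using t d by (auto simp: in_box_complex_iff R_def)
  have Pbox: "z \<in> box (Complex (-R) (-d')) (Complex R d')" if zP: "z \<in> P" for z
  proof -
    obtain k where k: "z = ?p k" "k \<in> {-int m..int m}" using zP unfolding P_def by blast
    have "real_of_int k * h < (real m + 1/2) * h" "(- (real m + 1/2)) * h < real_of_int k * h"
      using k(2) h by (auto intro!: mult_strict_right_mono)
    thus ?thesis using d k by (auto simp: in_box_complex_iff R_def algebra_simps)
  qed
  have R0: "R > 0" using h by (simp add: R_def)
  have cboxS: "cbox (Complex (-R) (-d')) (Complex R d') \<subseteq> S"
  proof -
    have "R < (real m + 1) * h" unfolding R_def using h by (intro mult_strict_right_mono) auto
    thus ?thesis using d by (auto simp: in_cbox_complex_iff in_box_complex_iff S_def)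
  qed
  have tS: "complex_of_real t \<in> S" using tbox cboxS box_subset_cbox by blast
  have sin_nz: "sin (of_real w * z) \<noteq> 0" if "z \<in> S - P" for z
  proof
    assume "sin (of_real w * z) = 0"
    then obtain k where "z = ?p k" using sin_scaled_eq_0_imp_grid[OF h] unfolding w_def by blast
    thus False using that grid_S[of k] by (auto simp: P_def)
  qed
  have "contour_integral (rectpath (Complex (-R) (-d')) (Complex R d')) F
          = 2 * pi * \<i> * (\<Sum>p\<in>pts. winding_number (rectpath (Complex (-R) (-d')) (Complex R d')) p * residue F p)"
  proof (rule Residue_theorem)
    show "open S" "connected S" by (auto simp: S_def convex_connected)
    show "F holomorphic_on S - pts"
      unfolding F_def using sin_nz S_strip
      by (intro holomorphic_intros holomorphic_on_subset[OF holo]) (auto simp: pts_def)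
    show "path_image (rectpath (Complex (- R) (- d')) (Complex R d')) \<subseteq> S - pts"
      using path_image_rectpath_subset_cbox[of "Complex (-R) (-d')" "Complex R d'"]
            path_image_rectpath_inter_box[of "Complex (-R) (-d')" "Complex R d'"] R0 d cboxS tbox Pbox
      by (auto simp: pts_def)
    show "\<forall>z. z \<notin> S \<longrightarrow> winding_number (rectpath (Complex (- R) (- d')) (Complex R d')) z = 0"
      using R0 d cboxS by (auto intro!: winding_number_rectpath_outside)
  qed (auto simp: pts_def finP)
  also have "(\<Sum>p\<in>pts. winding_number (rectpath (Complex (-R) (-d')) (Complex R d')) p * residue F p) = (\<Sum>p\<in>pts. residue F p)"
    using tbox Pbox by (intro sum.cong) (auto simp: pts_def winding_number_rectpath)
  also have "\<dots> = residue F (of_real t) + (\<Sum>k\<in>{-int m..int m}. residue F (?p k))"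
    unfolding pts_def sum.insert[OF finP tP] unfolding P_def sum.reindex[OF injp] o_def ..
  also have "residue F (of_real t) = g (of_real t) / of_real (sin (w * t))"
  proof -
    have "residue F (of_real t) = g (of_real t) / sin (of_real w * of_real t)"
      unfolding F_def
    proof (rule residue_simple)
      show "open (S - P)" by (auto simp: S_def intro!: open_Diff finite_imp_closed finP)
      show "(\<lambda>z. g z / sin (of_real w * z)) holomorphic_on S - P"
        using sin_nz S_strip by (intro holomorphic_intros holomorphic_on_subset[OF holo]) auto
    qed (use tS tP in auto)
    thus ?thesis by (simp flip: sin_of_real)
  qed
  also have "(\<Sum>k\<in>{-int m..int m}. residue F (?p k)) =
     (\<Sum>k\<in>{-int m..int m}. g (?p k) / (?p k - of_real t) / (of_real w * of_real (cos (pi * real_of_int k))))"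
  proof (rule sum.cong[OF refl])
    fix k assume k: "k \<in> {-int m..int m}"
    have eqF: "F = (\<lambda>z. g z / (z - of_real t) / sin (of_real (pi / h) * z))"
      by (simp add: F_def w_def fun_eq_iff)
    show "residue F (?p k) = g (?p k) / (?p k - of_real t) / (of_real w * of_real (cos (pi * real_of_int k)))"
      unfolding eqF w_def
    proof (rule residue_over_scaled_sin[OF h])
      show "open (S - (pts - {?p k}))" by (auto simp: S_def pts_def intro!: open_Diff finite_imp_closed finP)
      show "(\<lambda>z. g z / (z - of_real t)) holomorphic_on S - (pts - {?p k})"
      proof (intro holomorphic_intros holomorphic_on_subset[OF holo])
        fix z assume z: "z \<in> S - (pts - {?p k})"
        show "z - of_real t \<noteq> 0" using z grid[of k] by (auto simp: pts_def simp del: of_real_mult)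
      qed (use S_strip in auto)
      show "?p k \<in> S - (pts - {?p k})" using k grid_S by auto
      fix j assume j: "?p j \<in> S - (pts - {?p k})"
      hence "?p j \<in> P" using grid_S unfolding P_def by blast
      hence "?p j = ?p k" using j by (auto simp: pts_def)
      thus "j = k" using h by simp
    qed
  qed
  finally have I: "contour_integral (rectpath (Complex (-R) (-d')) (Complex R d')) F = 2 * pi * \<i> *
     (g (of_real t) / of_real (sin (w * t)) + 
       (\<Sum>k\<in>{-int m..int m}. g (?p k) / (?p k - of_real t) / (of_real w * of_real (cos (pi * real_of_int k)))))" .
  have sn: "sin (w * t) \<noteq> 0"
  proof
    assume "sin (w * t) = 0"
    hence "sin (of_real (pi / h) * complex_of_real t) = 0"
      by (simp add: w_def sin_of_real flip: of_real_mult of_real_divide)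
    from sin_scaled_eq_0_imp_grid[OF h this] grid show False by (metis of_real_eq_iff)
  qed
  have summand: "g (?p k) / (?p k - of_real t) / (of_real w * of_real (cos (pi * real_of_int k))) * of_real (sin (w * t))
      = - (g (?p k) * of_real (sinc (pi * (t / h - real_of_int k))))" for k
  proof -
    define c where "c = cos (pi * real_of_int k)"
    \<comment> \<open>\<open>c\<close> is its own inverse, so the sign produced by shifting the sine
      by \<open>pi * k\<close> matches the sign that the residue carries in its denominator.\<close>
    have c: "c = 1 \<or> c = -1" unfolding c_def by (auto simp: cos_npi_int)
    have ne: "real_of_int k * h - t \<noteq> 0" using grid[of k] by auto
    have arg: "pi * (t / h - real_of_int k) = w * (t - real_of_int k * h)" 
      using h by (simp add: w_def field_simps)
    have "sin (w * (t - real_of_int k * h)) = sin (w * t - pi * real_of_int k)"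
      using h by (simp add: w_def field_simps)
    also have "\<dots> = sin (w * t) * c" by (simp add: sin_diff c_def)
    finally have "sinc (pi * (t / h - real_of_int k)) = sin (w * t) * c / (w * (t - real_of_int k * h))"
      unfolding arg using ne w by auto
    also have "\<dots> = - (sin (w * t) / ((real_of_int k * h - t) * (w * c)))"
      using c ne w by (auto simp: divide_simps) (auto simp: algebra_simps)
    finally have "sinc (pi * (t / h - real_of_int k)) = - (sin (w * t) / ((real_of_int k * h - t) * (w * c)))" .
    thus ?thesis by (simp add: c_def)
  qed
  have "contour_integral (rectpath (Complex (-R) (-d')) (Complex R d')) F * of_real (sin (w * t))
      = 2 * pi * \<i> * (g (of_real t) + (\<Sum>k\<in>{-int m..int m}. g (?p k) / (?p k - of_real t) / (of_real w * of_real (cos (pi * real_of_int k))) * of_real (sin (w * t))))"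
    unfolding I using sn by (simp add: sum_distrib_right distrib_right)
  thus ?thesis unfolding summand sum_negf add_uminus_conv_diff unfolding R_def F_def w_def .
qed

section \<open>Discretization error\<close>

lemma contour_integral_horizontal_linepath:
  assumes "a < b"
  shows "contour_integral (linepath (Complex a y) (Complex b y)) f = integral {a..b} (\<lambda>x. f (Complex x y))"
proof -
  have "linepath (Complex a y) (Complex b y) = (+) (\<i> * of_real y) \<circ> linepath (of_real a) (of_real b)"
    by (auto simp: linepath_def complex_eq_iff fun_eq_iff algebra_simps)
  moreover have "of_real x + \<i> * of_real y = Complex x y" for x by (simp add: complex_eq_iff)
  ultimately show ?thesis
    using assms by (simp add: contour_integral_translate contour_integral_linepath_Reals_eq)
qed

text \<open>Both lower bounds on the contour are read off from this identity: dropping the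
  \<open>sinh\<close> term serves the vertical sides, dropping the \<open>sin\<close> term the
  horizontal ones.\<close>

lemma norm_sin_complex_squared: "(norm (sin z))\<^sup>2 = (sin (Re z))\<^sup>2 + (sinh (Im z))\<^sup>2"
proof -
  have e: "exp (2 * Im z) = (exp (Im z))\<^sup>2" by (simp add: exp_double)
  show ?thesis
    unfolding norm_sin_squared e cos_double_sin
    by (simp add: sinh_def exp_minus power2_eq_square field_simps)
qed

lemma sinh_le_norm_sin: "sinh \<bar>Im z\<bar> \<le> norm (sin z)"
  by (rule power2_le_imp_le) (auto simp: norm_sin_complex_squared abs_if)

lemma has_integral_exp_minus_abs_atMost:
  fixes \<mu> A :: real
  assumes "\<mu> > 0" "A \<ge> 0"
  shows "((\<lambda>s. exp (- \<mu> * \<bar>s\<bar>)) has_integral exp (- \<mu> * A) / \<mu>) {..-A}"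
proof -
  let ?f = "\<lambda>s::real. exp (- \<mu> * \<bar>s\<bar>)"
  have "(?f has_integral exp (- \<mu> * A) / \<mu>) {A..}"
    using has_integral_exp_minus_to_infinity[OF assms(1), of A] assms(2) by (auto intro: has_integral_eq)
  hence "?f absolutely_integrable_on {A..} \<and> integral {A..} ?f = exp (- \<mu> * A) / \<mu>"
    by (auto intro!: nonnegative_absolutely_integrable_1 simp: integrable_on_def integral_unique)
  hence "(\<lambda>x. ?f (-x)) absolutely_integrable_on {..-A} \<and> integral {..-A} (\<lambda>x. ?f (-x)) = exp (- \<mu> * A) / \<mu>"
    by (subst has_absolute_integral_reflect_real[where B = "{A..}"]) auto
  thus ?thesis
    using set_lebesgue_integral_eq_integral(1) by (auto simp: has_integral_iff)
qed

lemma has_integral_exp_minus_abs: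
  fixes \<mu> :: real
  assumes "\<mu> > 0"
  shows "((\<lambda>s. exp (- \<mu> * \<bar>s\<bar>)) has_integral 2 / \<mu>) UNIV"
proof -
  let ?f = "\<lambda>s::real. exp (- \<mu> * \<bar>s\<bar>)"
  have 1: "(?f has_integral 1 / \<mu>) {0..}"
    using has_integral_exp_minus_to_infinity[OF assms, of 0] by (auto intro: has_integral_eq)
  have 2: "(?f has_integral 1 / \<mu>) {..0}"
    using has_integral_exp_minus_abs_atMost[OF assms, of 0] by simp
  have "(?f has_integral 1 / \<mu> + 1 / \<mu>) ({0..} \<union> {..0})"
  proof (rule has_integral_Un[OF 1 2])
    have "{0..} \<inter> {..0::real} = {0}" by auto
    thus "negligible ({0..} \<inter> {..0::real})" by simp
  qed
  moreover have "{0..} \<union> {..0::real} = UNIV" by auto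
  ultimately show ?thesis by simp
qed

lemma continuous_on_integral_sin_over_linear:
  fixes w a b :: real
  assumes "\<And>t. t \<in> {a..b} \<Longrightarrow> complex_of_real t \<notin> S"
  shows "continuous_on S (\<lambda>z. integral {a..b} (\<lambda>t. of_real (sin (w * t)) / (z - of_real t)))"
proof -
  have "continuous_on (S \<times> cbox a b) (\<lambda>(z, t). of_real (sin (w * t)) / (z - complex_of_real t))"
    unfolding case_prod_unfold using assms by (intro continuous_intros) (auto simp: mem_Times_iff)
  from integral_continuous_on_param[OF this] show ?thesis by simp
qed

text \<open>Fubini on one side of the contour: once parametrized, the integrand is jointly
  continuous on a compact rectangle, because the segment avoids the interval of integration.\<close>

lemma has_integral_contour_integral_linepath_swap:
  fixes p :: "complex \<Rightarrow> complex" and w a b :: real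
  assumes p: "continuous_on (closed_segment z1 z2) p"
    and ab: "\<And>t. t \<in> {a..b} \<Longrightarrow> complex_of_real t \<notin> closed_segment z1 z2"
  shows "((\<lambda>t. contour_integral (linepath z1 z2) (\<lambda>z. p z / (z - of_real t)) * of_real (sin (w * t)))
           has_integral contour_integral (linepath z1 z2)
             (\<lambda>z. p z * integral {a..b} (\<lambda>t. of_real (sin (w * t)) / (z - of_real t)))) {a..b}"
proof -
  let ?l = "linepath z1 z2"
  define G where "G = (\<lambda>t u. p (?l u) / (?l u - complex_of_real t) * (z2 - z1) * of_real (sin (w * t)))"
  have lseg: "?l u \<in> closed_segment z1 z2" if "u \<in> {0..1}" for u
    using that by (metis imageI linepath_image_01)
  have cont: "continuous_on ({a..b} \<times> {0..1}) (\<lambda>(t, u). G t u)"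
    unfolding G_def case_prod_unfold
  proof (intro continuous_intros)
    show "continuous_on ({a..b} \<times> {0..1}) (\<lambda>x. p (?l (snd x)))"
      by (rule continuous_on_compose2[OF p]) (auto simp: linepath_def intro!: continuous_intros lseg[unfolded linepath_def])
    show "continuous_on ({a..b} \<times> {0..1}) (\<lambda>x. ?l (snd x))"
      by (auto simp: linepath_def intro!: continuous_intros)
    show "\<forall>x\<in>{a..b} \<times> {0..1}. ?l (snd x) - complex_of_real (fst x) \<noteq> 0"
      using ab lseg by fastforce
  qed
  have 1: "contour_integral ?l (\<lambda>z. p z / (z - of_real t)) * of_real (sin (w * t)) = integral {0..1} (G t)" for t
    by (simp add: contour_integral_integral G_def del: integral_mult_left flip: integral_mult_left)
  have 2: "contour_integral ?l (\<lambda>z. p z * integral {a..b} (\<lambda>t. of_real (sin (w * t)) / (z - of_real t)))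
     = integral {0..1} (\<lambda>u. integral {a..b} (\<lambda>t. G t u))"
  proof -
    have "integral {a..b} (\<lambda>t. G t u) = p (?l u) * (z2 - z1) * integral {a..b} (\<lambda>t. of_real (sin (w * t)) / (?l u - of_real t))" for u
      unfolding integral_mult_right[symmetric] by (simp add: G_def field_simps)
    thus ?thesis by (simp add: contour_integral_integral mult_ac)
  qed
  have "(\<lambda>t. integral {0..1} (G t)) integrable_on {a..b}"
    using integral_continuous_on_param[of "{a..b}" 0 1 G] cont by (auto intro!: integrable_continuous_interval)
  moreover have "integral {a..b} (\<lambda>t. integral {0..1} (G t)) = integral {0..1} (\<lambda>u. integral {a..b} (\<lambda>t. G t u))"
    using integral_swap_continuous[of a 0 b 1 G] cont by (simp add: cbox_Pair_eq)
  ultimately show ?thesis unfolding 1 2 by (auto simp: has_integral_iff)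
qed

text \<open>The horizontal sides give the first summand, by the kernel bound with
  \<open>\<bar>Im z\<bar> = d'\<close>. On the vertical sides \<open>Im z\<close> may vanish, so the
  kernel is bounded by \<open>(b - a) / \<delta>\<close> instead, and the decay of \<open>g\<close>
  makes the second summand small for large \<open>R\<close>.\<close>

lemma indefinite_sinc_rectangle_bound:
  fixes g :: "complex \<Rightarrow> complex" and d d' h a b \<mu> G \<delta> R :: real and m :: nat
  assumes holo: "g holomorphic_on strip d" and d: "0 < d'" "d' < d" and h: "h > 0"
    and \<mu>: "\<mu> > 0" and G: "G \<ge> 0"
    and bound: "\<And>z. z \<in> strip d \<Longrightarrow> norm (g z) \<le> G * exp (- \<mu> * \<bar>Re z\<bar>)"
    and R: "R = (real m + 1/2) * h"
    and ab: "a \<le> b" "\<delta> > 0" "- (R - \<delta>) \<le> a" "b \<le> R - \<delta>"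
  shows "norm (integral {a..b} (\<lambda>t. g (of_real t)) -
           (\<Sum>k\<in>{-int m..int m}. g (of_real (real_of_int k * h)) * of_real (Jfun k h b - Jfun k h a)))
         \<le> 2 * G * h / (pi * \<mu> * d' * sinh (pi * d' / h)) + 2 * d' * G * exp (- \<mu> * R) * (b - a) / (pi * \<delta>)"
proof -
  define w where "w = pi / h"
  define p where "p = (\<lambda>z. g z / sin (of_real w * z))"
  define \<Phi> where "\<Phi> = (\<lambda>z. integral {a..b} (\<lambda>t. of_real (sin (w * t)) / (z - complex_of_real t)))"
  define Q where "Q = {z. (\<bar>Re z\<bar> = R \<and> \<bar>Im z\<bar> \<le> d') \<or> (\<bar>Im z\<bar> = d' \<and> \<bar>Re z\<bar> \<le> R)}"
  define E where "E = (\<lambda>t. g (of_real t) - (\<Sum>k\<in>{-int m..int m}. g (of_real (real_of_int k * h))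
             * of_real (sinc (pi * (t / h - real_of_int k)))))"
  define z1 z2 z3 z4 where "z1 = Complex (-R) (-d')" and "z2 = Complex R (-d')"
    and "z3 = Complex R d'" and "z4 = Complex (-R) d'"
  note z_defs = z1_def z2_def z3_def z4_def
  have w: "w > 0" using h by (simp add: w_def)
  have R0: "R > 0" using h R by simp
  have ab_R: "\<bar>t\<bar> \<le> R - \<delta>" if "t \<in> {a..b}" for t using that ab by auto
  have Q_strip: "Q \<subseteq> strip d" using d by (auto simp: Q_def strip_def)
  have seg: "closed_segment z1 z2 \<subseteq> Q" "closed_segment z2 z3 \<subseteq> Q" "closed_segment z3 z4 \<subseteq> Q"
      "closed_segment z4 z1 \<subseteq> Q"
    using R0 d unfolding z_defs Q_def
    by (auto simp: closed_segment_same_Im closed_segment_same_Re closed_segment_eq_real_ivl)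
  have sin_vert: "1 \<le> norm (sin (of_real w * z))" if "\<bar>Re z\<bar> = R" for z
  proof -
    \<comment> \<open>The half-integer multiple of \<open>h\<close> in \<open>R\<close> puts the
      vertical sides midway between two poles, where the sine on the real axis is 1 or -1.\<close>
    have "w * R = pi / 2 + real m * pi" using h by (simp add: w_def R field_simps)
    hence c: "(sin (w * R))\<^sup>2 = 1" by (simp add: sin_add power2_eq_square flip: power_mult_distrib)
    have "(sin (w * Re z))\<^sup>2 = (sin (w * R))\<^sup>2" using that by (auto simp: abs_if split: if_splits)
    hence "1 \<le> (norm (sin (of_real w * z)))\<^sup>2" by (simp add: norm_sin_complex_squared c)
    thus ?thesis by (metis abs_norm_cancel abs_square_le_1 linorder_not_less order_le_less one_power2 power2_le_imp_le norm_ge_zero)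
  qed
  have sin_hor: "sinh (w * d') \<le> norm (sin (of_real w * z))" if "\<bar>Im z\<bar> = d'" for z
    using sinh_le_norm_sin[of "of_real w * z"] that w by (simp add: abs_mult)
  have sinh0: "sinh (w * d') > 0" using w d by simp
  have sin_nz: "sin (of_real w * z) \<noteq> 0" if "z \<in> Q" for z
    using that sin_vert[of z] sin_hor[of z] sinh0 by (auto simp: Q_def)
  have tQ: "complex_of_real t \<notin> Q" if "t \<in> {a..b}" for t
    using ab_R[OF that] ab(2) d by (auto simp: Q_def)
  have p_cont: "continuous_on Q p" unfolding p_def
    using sin_nz by (intro continuous_intros holomorphic_on_imp_continuous_on holomorphic_on_subset[OF holo Q_strip]) auto
  have \<Phi>_cont: "continuous_on Q \<Phi>" unfolding \<Phi>_def by (rule continuous_on_integral_sin_over_linear[OF tQ])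
  have p\<Phi>: "continuous_on Q (\<lambda>z. p z * \<Phi> z)" by (intro continuous_intros p_cont \<Phi>_cont)

  define T where "T = contour_integral (linepath z1 z2) (\<lambda>z. p z * \<Phi> z) + (contour_integral (linepath z2 z3) (\<lambda>z. p z * \<Phi> z)
     + (contour_integral (linepath z3 z4) (\<lambda>z. p z * \<Phi> z) + contour_integral (linepath z4 z1) (\<lambda>z. p z * \<Phi> z)))"
  have "((\<lambda>t. contour_integral (rectpath z1 z3) (\<lambda>z. p z / (z - of_real t)) * of_real (sin (w * t))) has_integral T) {a..b}"
  proof -
    have swap: "((\<lambda>t. contour_integral (linepath u v) (\<lambda>z. p z / (z - of_real t)) * of_real (sin (w * t)))
        has_integral contour_integral (linepath u v) (\<lambda>z. p z * \<Phi> z)) {a..b}" if "closed_segment u v \<subseteq> Q" for u v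
      unfolding \<Phi>_def using that tQ
      by (intro has_integral_contour_integral_linepath_swap continuous_on_subset[OF p_cont]) auto
    have split: "contour_integral (rectpath z1 z3) (\<lambda>z. p z / (z - of_real t)) * of_real (sin (w * t)) =
       contour_integral (linepath z1 z2) (\<lambda>z. p z / (z - of_real t)) * of_real (sin (w * t)) +
       (contour_integral (linepath z2 z3) (\<lambda>z. p z / (z - of_real t)) * of_real (sin (w * t)) +
       (contour_integral (linepath z3 z4) (\<lambda>z. p z / (z - of_real t)) * of_real (sin (w * t)) +
        contour_integral (linepath z4 z1) (\<lambda>z. p z / (z - of_real t)) * of_real (sin (w * t))))" if t: "t \<in> {a..b}" for t
    proof -
      have ci: "(\<lambda>z. p z / (z - of_real t)) contour_integrable_on linepath u v" if uv: "closed_segment u v \<subseteq> Q" for u v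
      proof (rule contour_integrable_continuous_linepath, intro continuous_intros)
        show "continuous_on (closed_segment u v) p" using p_cont uv continuous_on_subset by blast
      qed (use uv tQ[OF t] in auto)
      have "rectpath z1 z3 = linepath z1 z2 +++ linepath z2 z3 +++ linepath z3 z4 +++ linepath z4 z1"
        by (simp add: rectpath_def z_defs Let_def)
      thus ?thesis using ci seg by (simp add: distrib_right)
    qed
    have "((\<lambda>t. contour_integral (linepath z1 z2) (\<lambda>z. p z / (z - of_real t)) * of_real (sin (w * t)) +
       (contour_integral (linepath z2 z3) (\<lambda>z. p z / (z - of_real t)) * of_real (sin (w * t)) +
       (contour_integral (linepath z3 z4) (\<lambda>z. p z / (z - of_real t)) * of_real (sin (w * t)) +
        contour_integral (linepath z4 z1) (\<lambda>z. p z / (z - of_real t)) * of_real (sin (w * t))))) has_integral T) {a..b}"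
      unfolding T_def by (intro has_integral_add swap seg)
    thus ?thesis by (rule has_integral_eq[rotated]) (use split in auto)
  qed
  hence T1: "((\<lambda>t. 2 * pi * \<i> * E t) has_integral T) {a..b}"
  proof (rule has_integral_spike[rotated -1])
    \<comment> \<open>The contour formula holds for \<open>t\<close> off the grid; the grid is
      countable and thus invisible to the integral.\<close>
    have "negligible (\<Union> (range (\<lambda>k::int. {real_of_int k * h})))"
      by (rule negligible_countable_Union) auto
    moreover have "\<Union> (range (\<lambda>k::int. {real_of_int k * h})) = range (\<lambda>k::int. real_of_int k * h)" by auto
    ultimately show "negligible (range (\<lambda>k::int. real_of_int k * h))" by simp
    fix t assume t: "t \<in> {a..b} - range (\<lambda>k::int. real_of_int k * h)"
    have tR: "\<bar>t\<bar> < (real m + 1/2) * h" using ab_R[of t] t ab(2) R by auto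
    have grid: "t \<noteq> real_of_int k * h" for k :: int using t by auto
    show "2 * pi * \<i> * E t = contour_integral (rectpath z1 z3) (\<lambda>z. p z / (z - of_real t)) * of_real (sin (w * t))"
      unfolding E_def p_def w_def z1_def z3_def R using sinc_interpolation_contour[OF holo d h tR grid] by (rule sym)
  qed
  have T2: "(E has_integral (integral {a..b} (\<lambda>t. g (of_real t)) -
           (\<Sum>k\<in>{-int m..int m}. g (of_real (real_of_int k * h)) * of_real (Jfun k h b - Jfun k h a)))) {a..b}"
    unfolding E_def
  proof (intro has_integral_diff has_integral_sum)
    have "continuous_on {a..b} (\<lambda>t. g (of_real t))"
      by (rule continuous_on_compose2[OF holomorphic_on_imp_continuous_on[OF holo]])
         (use d in \<open>auto intro!: continuous_intros simp: strip_def\<close>)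
    thus "((\<lambda>t. g (of_real t)) has_integral integral {a..b} (\<lambda>t. g (of_real t))) {a..b}"
      using integrable_continuous_interval by blast
    fix k :: int
    have "((\<lambda>t. sinc (pi * (t / h - real_of_int k))) has_integral Jfun k h b - Jfun k h a) {a..b}"
      using Jfun_has_real_derivative[OF h]
      by (intro fundamental_theorem_of_calculus[OF ab(1)])
         (metis has_field_derivative_at_within has_real_derivative_iff_has_vector_derivative)
    from has_integral_of_real[OF this]
    show "((\<lambda>t. g (of_real (real_of_int k * h)) * of_real (sinc (pi * (t / h - real_of_int k)))) has_integral 
            g (of_real (real_of_int k * h)) * of_real (Jfun k h b - Jfun k h a)) {a..b}"
      by (rule has_integral_mult_right)
  qed auto
  let ?D = "integral {a..b} (\<lambda>t. g (of_real t)) -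
           (\<Sum>k\<in>{-int m..int m}. g (of_real (real_of_int k * h)) * of_real (Jfun k h b - Jfun k h a))"
  have "T = 2 * pi * \<i> * ?D"
    using has_integral_unique[OF T1 has_integral_mult_right[OF T2, of "2 * pi * \<i>"]] .
  hence normD: "norm ?D = norm T / (2 * pi)" by (simp add: norm_mult)

  \<comment> \<open>The factors bound \<open>p\<close> up to its exponential, the kernel, and the
    integral of the exponential. The last is taken over the whole line, so \<open>H\<close> does not
    depend on \<open>R\<close>.\<close>
  define H where "H = G / sinh (w * d') * (pi / (w * d')) * (2 / \<mu>)"
  have hor: "norm (contour_integral (linepath (Complex (-R) y) (Complex R y)) (\<lambda>z. p z * \<Phi> z)) \<le> H" if y: "\<bar>y\<bar> = d'" for y
  proof -
    define c where "c = G / sinh (w * d') * (pi / (w * d'))"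
    have Qy: "Complex x y \<in> Q" if "x \<in> {-R..R}" for x using that y by (auto simp: Q_def)
    have e_int: "(\<lambda>x. exp (- \<mu> * \<bar>x\<bar>)) integrable_on {-R..R}" 
      by (intro integrable_continuous_interval continuous_intros)
    have "norm (integral {-R..R} (\<lambda>x. p (Complex x y) * \<Phi> (Complex x y))) \<le> integral {-R..R} (\<lambda>x. c * exp (- \<mu> * \<bar>x\<bar>))"
    proof (rule integral_norm_bound_integral)
      have "continuous_on {-R..R} (\<lambda>x. Complex x y)"
        unfolding Complex_eq by (intro continuous_intros)
      hence "continuous_on {-R..R} (\<lambda>x. p (Complex x y) * \<Phi> (Complex x y))"
        by (rule continuous_on_compose2[OF p\<Phi>]) (use Qy in auto)
      thus "(\<lambda>x. p (Complex x y) * \<Phi> (Complex x y)) integrable_on {-R..R}" by (rule integrable_continuous_interval)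
      show "(\<lambda>x. c * exp (- \<mu> * \<bar>x\<bar>)) integrable_on {-R..R}"
        by (intro integrable_continuous_interval continuous_intros)
      fix x assume x: "x \<in> {-R..R}"
      have "norm (p (Complex x y)) = norm (g (Complex x y)) / norm (sin (of_real w * Complex x y))"
        by (simp add: p_def norm_divide)
      also have "\<dots> \<le> (G * exp (- \<mu> * \<bar>x\<bar>)) / sinh (w * d')"
        using bound[of "Complex x y"] Qy[OF x] Q_strip sin_hor[of "Complex x y"] y sinh0 G
        by (intro frac_le) auto
      finally have 1: "norm (p (Complex x y)) \<le> (G * exp (- \<mu> * \<bar>x\<bar>)) / sinh (w * d')" .
      have 2: "norm (\<Phi> (Complex x y)) \<le> pi / (w * d')"
        unfolding \<Phi>_def using norm_integral_sin_over_linear_le[of "Complex x y" w a b] y d w ab(1) by auto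
      have "norm (p (Complex x y) * \<Phi> (Complex x y)) \<le> (G * exp (- \<mu> * \<bar>x\<bar>)) / sinh (w * d') * (pi / (w * d'))"
        unfolding norm_mult using G sinh0 by (intro mult_mono[OF 1 2]) auto
      thus "norm (p (Complex x y) * \<Phi> (Complex x y)) \<le> c * exp (- \<mu> * \<bar>x\<bar>)" by (simp add: c_def mult_ac)
    qed
    also have "\<dots> = c * integral {-R..R} (\<lambda>x. exp (- \<mu> * \<bar>x\<bar>))" by simp
    also have "\<dots> \<le> c * (2 / \<mu>)"
    proof (rule mult_left_mono)
      have "integral {-R..R} (\<lambda>x. exp (- \<mu> * \<bar>x\<bar>)) \<le> integral UNIV (\<lambda>x. exp (- \<mu> * \<bar>x\<bar>))"
        using has_integral_exp_minus_abs[OF \<mu>] by (intro integral_subset_le e_int) (auto simp: integrable_on_def)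
      also have "\<dots> = 2 / \<mu>" using has_integral_exp_minus_abs[OF \<mu>] by (rule integral_unique)
      finally show "integral {-R..R} (\<lambda>x. exp (- \<mu> * \<bar>x\<bar>)) \<le> 2 / \<mu>" .
      show "c \<ge> 0" using G sinh0 w d by (simp add: c_def)
    qed
    finally show ?thesis using R0 by (simp add: contour_integral_horizontal_linepath H_def c_def)
  qed
  define V where "V = G * exp (- \<mu> * R) * ((b - a) / \<delta>)"
  have vert: "norm (p z * \<Phi> z) \<le> V" if z: "z \<in> Q" "\<bar>Re z\<bar> = R" for z
  proof -
    have "norm (p z) = norm (g z) / norm (sin (of_real w * z))"
      by (simp add: p_def norm_divide)
    also have "\<dots> \<le> (G * exp (- \<mu> * R)) / 1"
      using bound[of z] Q_strip z sin_vert[of z] G by (intro frac_le) auto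
    finally have 1: "norm (p z) \<le> G * exp (- \<mu> * R)" by simp
    have "norm (integral {a..b} (\<lambda>t. of_real (sin (w * t)) / (z - complex_of_real t))) \<le> integral {a..b} (\<lambda>t. 1 / \<delta>)"
    proof (rule integral_norm_bound_integral)
      show "(\<lambda>t. of_real (sin (w * t)) / (z - complex_of_real t)) integrable_on {a..b}"
        using z(1) tQ by (intro integrable_continuous_interval continuous_intros) auto
      fix t assume t: "t \<in> {a..b}"
      have "\<delta> \<le> \<bar>Re (z - of_real t)\<bar>" using ab_R[OF t] z(2) by auto
      hence "\<delta> \<le> norm (z - of_real t)" using abs_Re_le_cmod order.trans by blast
      thus "norm (of_real (sin (w * t)) / (z - complex_of_real t)) \<le> 1 / \<delta>"
        using ab(2) unfolding norm_divide by (intro frac_le) auto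
    qed auto
    hence 2: "norm (\<Phi> z) \<le> (b - a) / \<delta>" using ab(1) by (simp add: \<Phi>_def)
    show ?thesis unfolding norm_mult V_def using G by (intro mult_mono 1 2) auto
  qed
  have V0: "V \<ge> 0" using G ab by (simp add: V_def)
  have vl: "norm (contour_integral (linepath u v) (\<lambda>z. p z * \<Phi> z)) \<le> V * norm (v - u)"
    if "closed_segment u v \<subseteq> Q" "\<And>z. z \<in> closed_segment u v \<Longrightarrow> \<bar>Re z\<bar> = R" for u v
    using that V0 by (intro contour_integral_bound_linepath contour_integrable_continuous_linepath continuous_on_subset[OF p\<Phi>] vert) auto
  have b12: "norm (contour_integral (linepath z1 z2) (\<lambda>z. p z * \<Phi> z)) \<le> H"
    unfolding z_defs using d by (intro hor) auto
  have b34: "norm (contour_integral (linepath z3 z4) (\<lambda>z. p z * \<Phi> z)) \<le> H"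
  proof -
    have "contour_integral (linepath z3 z4) (\<lambda>z. p z * \<Phi> z) = - contour_integral (linepath z4 z3) (\<lambda>z. p z * \<Phi> z)"
      using seg by (intro contour_integral_reverse_linepath continuous_on_subset[OF p\<Phi>])
    thus ?thesis unfolding z_defs using d hor[of d'] by simp
  qed
  have "norm (z3 - z2) = 2 * d'" "norm (z1 - z4) = 2 * d'" using d by (auto simp: z_defs cmod_def real_sqrt_mult)
  hence b23: "norm (contour_integral (linepath z2 z3) (\<lambda>z. p z * \<Phi> z)) \<le> V * (2 * d')"
    and b41: "norm (contour_integral (linepath z4 z1) (\<lambda>z. p z * \<Phi> z)) \<le> V * (2 * d')"
    using vl[OF seg(2)] vl[OF seg(4)] R0 by (auto simp: z_defs closed_segment_same_Re)
  have "norm T \<le> H + (V * (2 * d') + (H + V * (2 * d')))"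
    unfolding T_def by (intro norm_triangle_mono b12 b23 b34 b41)
  hence "norm ?D \<le> (2 * H + 4 * d' * V) / (2 * pi)"
    unfolding normD by (intro divide_right_mono) (auto simp: mult_ac)
  also have "\<dots> = H / pi + 2 * d' * V / pi" by (simp add: add_divide_distrib)
  also have "H / pi = 2 * G * h / (pi * \<mu> * d' * sinh (pi * d' / h))"
    using h unfolding H_def w_def by (simp add: mult_ac)
  also have "2 * d' * V / pi = 2 * d' * G * exp (- \<mu> * R) * (b - a) / (pi * \<delta>)"
    by (simp add: V_def mult_ac)
  finally show ?thesis .
qed

lemma absolutely_integrable_exp_decay:
  fixes g :: "real \<Rightarrow> complex"
  assumes "\<mu> > 0" "continuous_on UNIV g" "\<And>t. norm (g t) \<le> G * exp (- \<mu> * \<bar>t\<bar>)" "S \<in> sets lebesgue"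
  shows "g absolutely_integrable_on S"
proof -
  have "g absolutely_integrable_on UNIV"
  proof (rule measurable_bounded_by_integrable_imp_absolutely_integrable)
    show "g \<in> borel_measurable (lebesgue_on UNIV)"
      using assms(2) by (intro continuous_imp_measurable_on_sets_lebesgue) auto
    show "(\<lambda>t. G * exp (- \<mu> * \<bar>t\<bar>)) integrable_on UNIV"
      using has_integral_mult_right[OF has_integral_exp_minus_abs[OF assms(1)], of G] by (auto simp: integrable_on_def)
  qed (use assms(3) in auto)
  thus ?thesis using assms(4) by (rule set_integrable_subset) auto
qed

text \<open>Index 0 is counted twice on the right, hence an inequality. The passage to natural
  indices prepares for Tannery's theorem.\<close>

lemma sum_symmetric_int_le:
  fixes F :: "int \<Rightarrow> real"
  assumes "\<And>k. F k \<ge> 0"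
  shows "(\<Sum>k\<in>{-int m..int m}. F k) \<le> (\<Sum>j\<le>m. F (int j) + F (- int j))"
proof (induction m)
  case (Suc m)
  have "{-int (Suc m)..int (Suc m)} = insert (int (Suc m)) (insert (- int (Suc m)) {-int m..int m})" by auto
  hence "(\<Sum>k\<in>{-int (Suc m)..int (Suc m)}. F k) = F (int (Suc m)) + (F (- int (Suc m)) + (\<Sum>k\<in>{-int m..int m}. F k))"
    by simp
  with Suc show ?case by simp
qed (use assms in auto)

text \<open>The number of terms grows with \<open>m\<close>, so the limits of single terms do not
  suffice. Tannery's theorem applies, with a geometric majorant from the decay of \<open>g\<close>
  on the grid and the uniform bound on \<open>Jfun\<close>.\<close>

lemma indefinite_sinc_sum_at_bot:
  fixes g :: "complex \<Rightarrow> complex" and h \<mu> G :: real and A :: "nat \<Rightarrow> real"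
  assumes h: "h > 0" and \<mu>: "\<mu> > 0" and G: "G \<ge> 0"
    and bound: "\<And>t. norm (g (of_real t)) \<le> G * exp (- \<mu> * \<bar>t\<bar>)"
    and A: "filterlim A at_bot sequentially"
  shows "(\<lambda>m. \<Sum>k\<in>{-int m..int m}. g (of_real (real_of_int k * h)) * of_real (Jfun k h (A m))) \<longlonglongrightarrow> 0"
proof -
  define c where "c = (\<lambda>j::nat. G * exp (- \<mu> * h) ^ j)"
  \<comment> \<open>Setting the terms beyond \<open>m\<close> to 0 turns the finite sum into a
    series with a fixed index range.\<close>
  define a where "a = (\<lambda>j m. if j \<le> m then c j * (\<bar>Jfun (int j) h (A m)\<bar> + \<bar>Jfun (- int j) h (A m)\<bar>) else 0)"
  have c0: "c j \<ge> 0" for j using G by (simp add: c_def)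
  have J0: "(\<lambda>m. \<bar>Jfun k h (A m)\<bar>) \<longlonglongrightarrow> 0" for k
    using filterlim_compose[OF Jfun_at_bot[OF h] A] by (rule tendsto_rabs_zero)
  have "((\<lambda>m. suminf (\<lambda>j. a j m)) \<longlongrightarrow> suminf (\<lambda>j. 0)) sequentially"
  proof (rule tannerys_theorem[THEN conjunct2, THEN conjunct2])
    show "(\<lambda>m. a j m) \<longlonglongrightarrow> 0" for j
    proof (rule tendsto_sandwich[OF _ _ tendsto_const])
      show "\<forall>\<^sub>F m in sequentially. 0 \<le> a j m" using c0 by (auto simp: a_def)
      show "\<forall>\<^sub>F m in sequentially. a j m \<le> c j * (\<bar>Jfun (int j) h (A m)\<bar> + \<bar>Jfun (- int j) h (A m)\<bar>)"
        using c0 by (auto simp: a_def)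
      show "(\<lambda>m. c j * (\<bar>Jfun (int j) h (A m)\<bar> + \<bar>Jfun (- int j) h (A m)\<bar>)) \<longlonglongrightarrow> 0"
        by (rule tendsto_eq_intros J0 refl | simp)+
    qed
    show "summable (\<lambda>j. c j * (11/10 * h + 11/10 * h))"
      unfolding c_def using h \<mu> by (intro summable_mult2 summable_mult summable_geometric) auto
    show "\<forall>\<^sub>F (j, m) in at_top \<times>\<^sub>F sequentially. norm (a j m) \<le> c j * (11/10 * h + 11/10 * h)"
    proof (intro always_eventually allI, clarify)
      fix j m
      have "c j * (\<bar>Jfun (int j) h (A m)\<bar> + \<bar>Jfun (- int j) h (A m)\<bar>) \<le> c j * (11/10 * h + 11/10 * h)"
        by (intro mult_left_mono add_mono abs_Jfun_le h c0)
      thus "norm (a j m) \<le> c j * (11/10 * h + 11/10 * h)" using c0[of j] h by (auto simp: a_def)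
    qed
  qed simp
  moreover have "suminf (\<lambda>j. a j m) = (\<Sum>j\<le>m. a j m)" for m
    by (rule suminf_finite) (auto simp: a_def)
  ultimately have lim: "(\<lambda>m. \<Sum>j\<le>m. a j m) \<longlonglongrightarrow> 0" by simp
  show ?thesis
  proof (rule Lim_null_comparison[OF always_eventually lim], rule allI)
    fix m
    define F where "F = (\<lambda>k. G * exp (- \<mu> * \<bar>real_of_int k * h\<bar>) * \<bar>Jfun k h (A m)\<bar>)"
    have "norm (\<Sum>k\<in>{-int m..int m}. g (of_real (real_of_int k * h)) * of_real (Jfun k h (A m))) \<le> (\<Sum>k\<in>{-int m..int m}. F k)"
      unfolding F_def by (intro sum_norm_le) (simp only: norm_mult norm_of_real, intro mult_right_mono bound abs_ge_zero)
    also have "\<dots> \<le> (\<Sum>j\<le>m. F (int j) + F (- int j))"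
      using G by (intro sum_symmetric_int_le) (simp add: F_def)
    also have "\<dots> = (\<Sum>j\<le>m. a j m)"
    proof (rule sum.cong[OF refl])
      fix j assume "j \<in> {..m}"
      moreover have "exp (- \<mu> * (real j * h)) = exp (- \<mu> * h) ^ j"
        by (simp add: exp_of_nat_mult[symmetric] mult_ac)
      ultimately show "F (int j) + F (- int j) = a j m"
        using h by (simp add: F_def a_def c_def abs_mult distrib_left)
    qed
    finally show "norm (\<Sum>k\<in>{-int m..int m}. g (of_real (real_of_int k * h)) * of_real (Jfun k h (A m))) \<le> (\<Sum>j\<le>m. a j m)" .
  qed
qed

lemma indefinite_sinc_discretization_error:
  fixes g :: "complex \<Rightarrow> complex" and d d' h x \<mu> G :: real
  assumes holo: "g holomorphic_on strip d" and d: "0 < d'" "d' < d" and h: "h > 0"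
    and \<mu>: "\<mu> > 0" and G: "G \<ge> 0"
    and bound: "\<And>z. z \<in> strip d \<Longrightarrow> norm (g z) \<le> G * exp (- \<mu> * \<bar>Re z\<bar>)"
  obtains \<epsilon> where "\<epsilon> \<longlonglongrightarrow> 0"
    and "eventually (\<lambda>m. norm (integral {..x} (\<lambda>t. g (of_real t)) -
           (\<Sum>k\<in>{-int m..int m}. g (of_real (real_of_int k * h)) * of_real (Jfun k h x)))
         \<le> 2 * G * h / (pi * \<mu> * d' * sinh (pi * d' / h)) + \<epsilon> m) sequentially"
proof -
  define B where "B = 2 * G * h / (pi * \<mu> * d' * sinh (pi * d' / h))"
  \<comment> \<open>The cut-off \<open>- A m\<close> tends to \<open>-\<infinity>\<close> while staying at a distance proportional to \<open>m\<close> from the sides.\<close>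
  define A where "A = (\<lambda>m::nat. real m * h / 2)"
  define s where "s = (\<lambda>m. \<Sum>k\<in>{-int m..int m}. g (of_real (real_of_int k * h)) * of_real (Jfun k h (- A m)))"
  \<comment> \<open>The three costs of the finite rectangle and the cut-off: the integral to the
    left of \<open>- A m\<close>, the vertical sides, and the basis functions evaluated at
    \<open>- A m\<close>.\<close>
  define \<epsilon> where "\<epsilon> = (\<lambda>m. G * (exp (- \<mu> * A m) / \<mu>) + 8 * d' * G * exp (- \<mu> * ((real m + 1/2) * h)) / pi + norm (s m))"
  have real_bound: "norm (g (of_real t)) \<le> G * exp (- \<mu> * \<bar>t\<bar>)" for t
    using bound[of "of_real t"] d by (simp add: strip_def)
  have g_cont: "continuous_on UNIV (\<lambda>t. g (of_real t))"
    by (rule continuous_on_compose2[OF holomorphic_on_imp_continuous_on[OF holo]])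
       (use d in \<open>auto intro!: continuous_intros simp: strip_def\<close>)
  have g_int: "(\<lambda>t. g (of_real t)) integrable_on S" if "S \<in> sets lebesgue" for S
    using absolutely_integrable_exp_decay[OF \<mu> g_cont real_bound that] set_lebesgue_integral_eq_integral(1) by blast
  have "(\<lambda>m. norm (s m)) \<longlonglongrightarrow> 0"
    unfolding s_def
  proof (rule tendsto_norm_zero, rule indefinite_sinc_sum_at_bot[OF h \<mu> G real_bound])
    show "filterlim (\<lambda>m. - A m) at_bot sequentially" unfolding A_def using h by real_asymp
  qed
  moreover have "(\<lambda>m. G * (exp (- \<mu> * A m) / \<mu>) + 8 * d' * G * exp (- \<mu> * ((real m + 1/2) * h)) / pi) \<longlonglongrightarrow> 0"
  proof -
    have "(\<lambda>m. exp (- \<mu> * A m)) \<longlonglongrightarrow> 0" unfolding A_def using h \<mu> by real_asymp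
    moreover have "(\<lambda>m. exp (- \<mu> * ((real m + 1/2) * h))) \<longlonglongrightarrow> 0" using h \<mu> by real_asymp
    ultimately have "(\<lambda>m. G * (exp (- \<mu> * A m) / \<mu>) + 8 * d' * G * exp (- \<mu> * ((real m + 1/2) * h)) / pi) 
        \<longlonglongrightarrow> G * (0 / \<mu>) + 8 * d' * G * 0 / pi" using \<mu> by (intro tendsto_intros) auto
    thus ?thesis by simp
  qed
  ultimately have "\<epsilon> \<longlonglongrightarrow> 0" unfolding \<epsilon>_def using tendsto_add by fastforce
  moreover have "eventually (\<lambda>m. norm (integral {..x} (\<lambda>t. g (of_real t)) -
           (\<Sum>k\<in>{-int m..int m}. g (of_real (real_of_int k * h)) * of_real (Jfun k h x))) \<le> B + \<epsilon> m) sequentially"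
  proof -
    have "filterlim A at_top sequentially" unfolding A_def using h by real_asymp
    hence "eventually (\<lambda>m. A m \<ge> \<bar>x\<bar> + 1) sequentially" by (simp add: filterlim_at_top)
    thus ?thesis
    proof eventually_elim
      case (elim m)
      define R where "R = (real m + 1/2) * h"
      have Apos: "A m > 0" and xA: "- A m \<le> x" "x \<le> A m" using elim by auto
      \<comment> \<open>\<open>A m / 2\<close> is going to be \<open>\<delta>\<close>. The interval
        has length at most \<open>2 * A m\<close>, so the ratio of the two is at most 4 and does not
        spoil the factor \<open>exp (- \<mu> * R)\<close>.\<close>
      have RA: "R - A m / 2 \<ge> A m"
        using h by (simp add: R_def A_def field_simps)
      let ?D = "integral {- A m..x} (\<lambda>t. g (of_real t)) -
           (\<Sum>k\<in>{-int m..int m}. g (of_real (real_of_int k * h)) * of_real (Jfun k h x - Jfun k h (- A m)))"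
      have "norm ?D \<le> B + 2 * d' * G * exp (- \<mu> * R) * (x - - A m) / (pi * (A m / 2))"
        unfolding B_def using RA Apos xA
        by (intro indefinite_sinc_rectangle_bound[OF holo d h \<mu> G bound R_def]) auto
      also have "2 * d' * G * exp (- \<mu> * R) * (x - - A m) / (pi * (A m / 2)) \<le>
                 2 * d' * G * exp (- \<mu> * R) * (2 * A m) / (pi * (A m / 2))"
        using Apos xA d G by (intro divide_right_mono mult_left_mono) auto
      also have "\<dots> = 8 * d' * G * exp (- \<mu> * R) / pi" using Apos by (simp add: field_simps)
      finally have D: "norm ?D \<le> B + 8 * d' * G * exp (- \<mu> * R) / pi" by simp
      have tail: "norm (integral {..- A m} (\<lambda>t. g (of_real t))) \<le> G * (exp (- \<mu> * A m) / \<mu>)"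
      proof -
        have "((\<lambda>s. G * exp (- \<mu> * \<bar>s\<bar>)) has_integral G * (exp (- \<mu> * A m) / \<mu>)) {..- A m}"
          using Apos by (intro has_integral_mult_right has_integral_exp_minus_abs_atMost \<mu>) auto
        thus ?thesis using integral_norm_bound_integral[OF g_int _ real_bound, of "{..- A m}"]
          by (auto simp: has_integral_iff)
      qed
      have "integral ({..- A m} \<union> {- A m..x}) (\<lambda>t. g (of_real t)) =
              integral {..- A m} (\<lambda>t. g (of_real t)) + integral {- A m..x} (\<lambda>t. g (of_real t))"
      proof (rule Henstock_Kurzweil_Integration.integral_Un)
        have "{..- A m} \<inter> {- A m..x} \<subseteq> {- A m}" by auto
        thus "negligible ({..- A m} \<inter> {- A m..x})" using negligible_subset negligible_sing by blast
      qed (auto intro: g_int)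
      moreover have "{..- A m} \<union> {- A m..x} = {..x}" using xA by auto
      ultimately have split: "integral {..x} (\<lambda>t. g (of_real t)) =
              integral {..- A m} (\<lambda>t. g (of_real t)) + integral {- A m..x} (\<lambda>t. g (of_real t))" by simp
      have "integral {..x} (\<lambda>t. g (of_real t)) -
           (\<Sum>k\<in>{-int m..int m}. g (of_real (real_of_int k * h)) * of_real (Jfun k h x))
           = integral {..- A m} (\<lambda>t. g (of_real t)) + ?D - s m"
        unfolding split s_def by (simp add: sum_subtractf algebra_simps)
      hence "norm (integral {..x} (\<lambda>t. g (of_real t)) -
           (\<Sum>k\<in>{-int m..int m}. g (of_real (real_of_int k * h)) * of_real (Jfun k h x)))
           \<le> norm (integral {..- A m} (\<lambda>t. g (of_real t))) + norm ?D + norm (s m)"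
        by (metis (no_types, lifting) add_right_mono norm_triangle_ineq norm_triangle_ineq4 order.trans)
      also have "\<dots> \<le> B + \<epsilon> m"
        using tail D by (simp add: \<epsilon>_def R_def)
      finally show ?case .
    qed
  qed
  ultimately show ?thesis unfolding B_def by (rule that)
qed

section \<open>Truncation error and the variable transformation\<close>

lemma sinh_complex_of_real: "sinh (complex_of_real x) = of_real (sinh x)"
  by (simp add: sinh_def scaleR_conv_of_real exp_of_real flip: of_real_minus)

lemma cosh_complex_of_real: "cosh (complex_of_real x) = of_real (cosh x)"
  by (simp add: cosh_def scaleR_conv_of_real exp_of_real flip: of_real_minus)

lemma norm_cosh_complex_squared: "(norm (cosh z))\<^sup>2 = (sinh (Re z))\<^sup>2 + (cos (Im z))\<^sup>2"
  by (simp add: cosh_conv_cos norm_cos_squared sinh_def exp_minus power_divide power_mult_distrib)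

text \<open>The squared norm is a sum of squares, and \<open>cos\<^sup>2 \<le> 1\<close> yields the
  product form. In the strip \<open>cos (Im z) \<ge> cos d\<close>, which is how a power of
  \<open>cos d\<close> enters \<open>C1\<close>.\<close>

lemma cosh_times_cos_le_norm_cosh: "cosh (Re z) * cos (Im z) \<le> norm (cosh z)"
proof (rule power2_le_imp_le)
  have "(cosh (Re z) * cos (Im z))\<^sup>2 = (cos (Im z))\<^sup>2 + (sinh (Re z))\<^sup>2 * (cos (Im z))\<^sup>2"
    by (simp add: power_mult_distrib cosh_square_eq algebra_simps)
  also have "\<dots> \<le> (cos (Im z))\<^sup>2 + (sinh (Re z))\<^sup>2 * 1"
    by (intro add_left_mono mult_left_mono) (auto simp: cos_squared_eq)
  finally show "(cosh (Re z) * cos (Im z))\<^sup>2 \<le> (norm (cosh z))\<^sup>2"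
    by (simp add: norm_cosh_complex_squared)
qed simp

lemma exp_abs_le_cosh: "exp \<bar>x\<bar> / 2 \<le> cosh (x::real)"
  by (auto simp: cosh_def abs_if)

text \<open>\<open>\<kappa>\<close> is \<open>cos d\<close> for the whole strip and 1 for the real
  axis. Hence the discretization part of \<open>C1\<close> carries \<open>cos d powr \<nu>\<close>
  and the truncation part does not.\<close>

lemma powr_minus_le_exp_decay:
  fixes c x \<kappa> \<gamma> :: real
  assumes "\<kappa> > 0" "\<gamma> \<ge> 0" "exp \<bar>x\<bar> / 2 * \<kappa> \<le> c"
  shows "c powr (-\<gamma>) \<le> 2 powr \<gamma> / \<kappa> powr \<gamma> * exp (- \<gamma> * \<bar>x\<bar>)"
proof -
  have "c powr (-\<gamma>) \<le> (exp \<bar>x\<bar> / 2 * \<kappa>) powr (-\<gamma>)"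
    using assms by (intro powr_mono2') auto
  also have "\<dots> = (exp \<bar>x\<bar>) powr (-\<gamma>) / 2 powr (-\<gamma>) * \<kappa> powr (-\<gamma>)"
    using assms by (simp add: powr_mult powr_divide)
  also have "(exp \<bar>x\<bar>) powr (-\<gamma>) = exp (- \<gamma> * \<bar>x\<bar>)"
    by (simp add: powr_def)
  finally show ?thesis by (simp add: powr_minus field_simps)
qed

text \<open>Since \<open>1 + sinh\<^sup>2 = cosh\<^sup>2\<close>, the assumed decay has order
  \<open>\<gamma> + 1\<close> in \<open>cosh\<close>, and the factor \<open>cosh z\<close> of the
  substitution costs one order.\<close>

lemma norm_times_cosh_le:
  fixes v z :: complex
  assumes "cosh z \<noteq> 0" "norm v \<le> K * norm (1 + (sinh z)\<^sup>2) powr (- (\<gamma> + 1) / 2)"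
  shows "norm (v * cosh z) \<le> K * norm (cosh z) powr (-\<gamma>)"
proof -
  define c where "c = norm (cosh z)"
  have c: "c > 0" using assms(1) by (simp add: c_def)
  have "norm (1 + (sinh z)\<^sup>2) = c\<^sup>2"
    by (simp add: c_def norm_power flip: cosh_square_eq[of z] add.commute[of _ 1])
  also have "\<dots> = c powr 2" using c by simp
  finally have "norm (1 + (sinh z)\<^sup>2) powr (- (\<gamma> + 1) / 2) = c powr (2 * (- (\<gamma> + 1) / 2))"
    by (simp only: powr_powr)
  also have "2 * (- (\<gamma> + 1) / 2) = - (\<gamma> + 1)" by simp
  finally have "norm (1 + (sinh z)\<^sup>2) powr (- (\<gamma> + 1) / 2) = c powr (- (\<gamma> + 1))" .
  hence "norm (v * cosh z) \<le> K * c powr (- (\<gamma> + 1)) * c"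
    using assms(2) c unfolding norm_mult c_def[symmetric] by (intro mult_right_mono) auto
  also have "\<dots> = K * (c powr (- (\<gamma> + 1)) * c powr 1)" using c by simp
  also have "c powr (- (\<gamma> + 1)) * c powr 1 = c powr (-\<gamma>)" by (subst powr_add[symmetric]) simp
  finally show ?thesis by (simp add: c_def)
qed

text \<open>A right-endpoint Riemann sum of a decreasing function lies below its integral; here this
  follows by telescoping from \<open>1 + \<beta> * h \<le> exp (\<beta> * h)\<close>. The weight
  \<open>h\<close> stems from the bound on \<open>Jfun\<close> and spares the result a factor
  \<open>1 / h\<close>.\<close>

lemma sum_exp_tail_le:
  fixes \<beta> h :: real and N m :: int
  assumes "\<beta> > 0" "h > 0"
  shows "(\<Sum>k\<in>{N<..m}. h * exp (- \<beta> * (real_of_int k * h))) \<le> exp (- \<beta> * (real_of_int N * h)) / \<beta>"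
proof (cases "N \<le> m")
  case True
  have "(\<Sum>k\<in>{N<..m}. h * exp (- \<beta> * (real_of_int k * h)))
          \<le> exp (- \<beta> * (real_of_int N * h)) / \<beta> - exp (- \<beta> * (real_of_int m * h)) / \<beta>"
    using True
  proof (induction m rule: int_ge_induct)
    case (step i)
    let ?e = "exp (- \<beta> * (real_of_int (i + 1) * h))"
    have "{N<..i+1} = insert (i+1) {N<..i}" using step.hyps by auto
    hence "(\<Sum>k\<in>{N<..i+1}. h * exp (- \<beta> * (real_of_int k * h))) = h * ?e + (\<Sum>k\<in>{N<..i}. h * exp (- \<beta> * (real_of_int k * h)))"
      by simp
    moreover have "h * ?e \<le> exp (- \<beta> * (real_of_int i * h)) / \<beta> - ?e / \<beta>"
    proof -
      have "exp (- \<beta> * (real_of_int i * h)) = exp (\<beta> * h) * ?e"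
        by (simp add: algebra_simps flip: exp_add)
      moreover have "(1 + \<beta> * h) * ?e \<le> exp (\<beta> * h) * ?e"
        by (intro mult_right_mono exp_ge_add_one_self) auto
      ultimately have "(1 + \<beta> * h) * ?e \<le> exp (- \<beta> * (real_of_int i * h))" by simp
      thus ?thesis using assms(1) by (simp add: field_simps)
    qed
    ultimately show ?case using step.IH by linarith
  qed auto
  moreover have "exp (- \<beta> * (real_of_int m * h)) / \<beta> \<ge> 0" using assms by simp
  ultimately show ?thesis by linarith
qed (use assms in simp)

text \<open>Each tail keeps its own rate and cut-off, so that unequal \<open>M\<close> and
  \<open>N\<close> can later be matched to unequal \<open>\<alpha>\<close> and
  \<open>\<beta>\<close>.\<close>

lemma indefinite_sinc_truncation_error:
  fixes g :: "complex \<Rightarrow> complex" and h \<alpha> \<beta> Ka Kb x :: real and M N m :: int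
  assumes h: "h > 0" and ab: "\<alpha> > 0" "\<beta> > 0" and K: "Ka \<ge> 0" "Kb \<ge> 0"
    and bneg: "\<And>t. t < 0 \<Longrightarrow> norm (g (of_real t)) \<le> Ka * exp (- \<alpha> * \<bar>t\<bar>)"
    and bpos: "\<And>t. t \<ge> 0 \<Longrightarrow> norm (g (of_real t)) \<le> Kb * exp (- \<beta> * \<bar>t\<bar>)"
    and MN: "0 \<le> M" "0 \<le> N" "M \<le> m" "N \<le> m"
  shows "norm ((\<Sum>k\<in>{-m..m}. g (of_real (real_of_int k * h)) * of_real (Jfun k h x)) -
               (\<Sum>k\<in>{-M..N}. g (of_real (real_of_int k * h)) * of_real (Jfun k h x)))
         \<le> 11/10 * (Ka * (exp (- \<alpha> * (real_of_int M * h)) / \<alpha>) + Kb * (exp (- \<beta> * (real_of_int N * h)) / \<beta>))"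
proof -
  let ?F = "\<lambda>k. g (of_real (real_of_int k * h)) * of_real (Jfun k h x)"
  have "{-m..m} = {-M..N} \<union> ({-m..<-M} \<union> {N<..m})" using MN by auto
  hence "sum ?F {-m..m} = sum ?F {-M..N} + (sum ?F {-m..<-M} + sum ?F {N<..m})"
    using MN by (simp only:) (subst sum.union_disjoint; (subst sum.union_disjoint)?; auto)
  hence "sum ?F {-m..m} - sum ?F {-M..N} = sum ?F {-m..<-M} + sum ?F {N<..m}" by simp
  also have "norm \<dots> \<le> 11/10 * (Ka * (exp (- \<alpha> * (real_of_int M * h)) / \<alpha>)) + 11/10 * (Kb * (exp (- \<beta> * (real_of_int N * h)) / \<beta>))"
  proof (rule norm_triangle_mono)
    have "norm (sum ?F {-m..<-M}) \<le> (\<Sum>k\<in>{-m..<-M}. 11/10 * (Ka * (h * exp (- \<alpha> * (real_of_int (-k) * h)))))"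
    proof (rule sum_norm_le)
      fix k assume k: "k \<in> {-m..<-M}"
      have neg: "real_of_int k * h < 0" using k MN h by (intro mult_neg_pos) auto
      have "norm (?F k) \<le> Ka * exp (- \<alpha> * \<bar>real_of_int k * h\<bar>) * (11/10 * h)"
        unfolding norm_mult norm_of_real using K by (intro mult_mono bneg neg abs_Jfun_le h) auto
      also have "\<bar>real_of_int k * h\<bar> = real_of_int (-k) * h" using neg by simp
      finally show "norm (?F k) \<le> 11/10 * (Ka * (h * exp (- \<alpha> * (real_of_int (-k) * h))))"
        by (simp only: mult_ac)
    qed
    also have "\<dots> = 11/10 * (Ka * (\<Sum>k\<in>{-m..<-M}. h * exp (- \<alpha> * (real_of_int (-k) * h))))"
      by (simp only: sum_distrib_left)
    also have "(\<Sum>k\<in>{-m..<-M}. h * exp (- \<alpha> * (real_of_int (-k) * h))) = (\<Sum>k\<in>{M<..m}. h * exp (- \<alpha> * (real_of_int k * h)))"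
      by (rule sum.reindex_bij_witness[of _ uminus uminus]) auto
    also have "11/10 * (Ka * \<dots>) \<le> 11/10 * (Ka * (exp (- \<alpha> * (real_of_int M * h)) / \<alpha>))"
      using K by (intro mult_left_mono sum_exp_tail_le ab h) auto
    finally show "norm (sum ?F {-m..<-M}) \<le> 11/10 * (Ka * (exp (- \<alpha> * (real_of_int M * h)) / \<alpha>))" .
    have "norm (sum ?F {N<..m}) \<le> (\<Sum>k\<in>{N<..m}. 11/10 * (Kb * (h * exp (- \<beta> * (real_of_int k * h)))))"
    proof (rule sum_norm_le)
      fix k assume k: "k \<in> {N<..m}"
      have pos: "real_of_int k * h \<ge> 0" using k MN h by auto
      have "norm (?F k) \<le> Kb * exp (- \<beta> * \<bar>real_of_int k * h\<bar>) * (11/10 * h)"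
        unfolding norm_mult norm_of_real using K by (intro mult_mono bpos pos abs_Jfun_le h) auto
      also have "\<bar>real_of_int k * h\<bar> = real_of_int k * h" using pos by simp
      finally show "norm (?F k) \<le> 11/10 * (Kb * (h * exp (- \<beta> * (real_of_int k * h))))"
        by (simp only: mult_ac)
    qed
    also have "\<dots> = 11/10 * (Kb * (\<Sum>k\<in>{N<..m}. h * exp (- \<beta> * (real_of_int k * h))))"
      by (simp only: sum_distrib_left)
    also have "\<dots> \<le> 11/10 * (Kb * (exp (- \<beta> * (real_of_int N * h)) / \<beta>))"
      using K by (intro mult_left_mono sum_exp_tail_le ab h) auto
    finally show "norm (sum ?F {N<..m}) \<le> 11/10 * (Kb * (exp (- \<beta> * (real_of_int N * h)) / \<beta>))" .
  qed
  finally show ?thesis by (simp add: distrib_left)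
qed

text \<open>\<open>sinh\<close> is an increasing bijection between the two half-lines with
  derivative \<open>cosh > 0\<close>. Change of variables is available for absolutely integrable
  functions, whence the hypothesis.\<close>

lemma integral_atMost_sinh_substitution:
  fixes f :: "complex \<Rightarrow> complex"
  assumes "(\<lambda>t. f (sinh (of_real t)) * cosh (of_real t)) absolutely_integrable_on {..arsinh \<tau>}"
  shows "integral {..\<tau>} (\<lambda>t. f (of_real t)) = integral {..arsinh \<tau>} (\<lambda>t. f (sinh (of_real t)) * cosh (of_real t))"
proof -
  have img: "sinh ` {..arsinh \<tau>} = {..\<tau>}"
  proof (intro equalityI subsetI)
    fix y assume "y \<in> {..\<tau>}"
    hence "arsinh y \<in> {..arsinh \<tau>}" by (metis atMost_iff sinh_arsinh_real sinh_real_le_iff)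
    thus "y \<in> sinh ` {..arsinh \<tau>}" by (metis imageI sinh_arsinh_real)
  next
    fix y assume "y \<in> sinh ` {..arsinh \<tau>}"
    then obtain s where "y = sinh s" "s \<le> arsinh \<tau>" by auto
    thus "y \<in> {..\<tau>}" by (metis atMost_iff sinh_arsinh_real sinh_real_le_iff)
  qed
  have eq: "\<bar>cosh t\<bar> *\<^sub>R f (of_real (sinh t)) = f (sinh (of_real t)) * cosh (of_real t)" for t :: real
    by (simp add: sinh_complex_of_real cosh_complex_of_real scaleR_conv_of_real)
  have "(\<lambda>t. \<bar>cosh t\<bar> *\<^sub>R f (of_real (sinh t))) absolutely_integrable_on {..arsinh \<tau>} \<and>
        integral {..arsinh \<tau>} (\<lambda>t. \<bar>cosh t\<bar> *\<^sub>R f (of_real (sinh t))) =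
          integral {..arsinh \<tau>} (\<lambda>t. f (sinh (of_real t)) * cosh (of_real t))
     \<longleftrightarrow> (\<lambda>t. f (of_real t)) absolutely_integrable_on (sinh ` {..arsinh \<tau>}) \<and>
        integral (sinh ` {..arsinh \<tau>}) (\<lambda>t. f (of_real t)) = integral {..arsinh \<tau>} (\<lambda>t. f (sinh (of_real t)) * cosh (of_real t))"
    by (rule has_absolute_integral_change_of_variables_real) (auto intro!: derivative_eq_intros simp: inj_on_def)
  thus ?thesis unfolding img eq using assms by blast
qed

theorem theorem10:
  fixes f :: "complex \<Rightarrow> complex" and d K \<alpha> \<beta> :: real and n :: nat
  assumes "0 < d" "d < pi / 2"
    and "f analytic_on (sinh ` strip d)"
    and "K > 0" "\<alpha> > 0" "\<beta> > 0"
    and "\<And>\<zeta>. \<zeta> \<in> strip d \<Longrightarrow> Re \<zeta> < 0 \<Longrightarrow>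
           norm (f (sinh \<zeta>)) \<le> K * norm (1 + (sinh \<zeta>)\<^sup>2) powr (- (\<alpha> + 1) / 2)"
    and "\<And>\<zeta>. \<zeta> \<in> strip d \<Longrightarrow> Re \<zeta> \<ge> 0 \<Longrightarrow>
           norm (f (sinh \<zeta>)) \<le> K * norm (1 + (sinh \<zeta>)\<^sup>2) powr (- (\<beta> + 1) / 2)"
    and "n > 0"
  defines "h \<equiv> sqrt (pi * d / ((min \<alpha> \<beta>) * real n))"
    and "M \<equiv> (if (min \<alpha> \<beta>) = \<alpha> then int n else \<lceil>\<beta> * real n / \<alpha>\<rceil>)"
    and "N \<equiv> (if (min \<alpha> \<beta>) = \<alpha> then \<lceil>\<alpha> * real n / \<beta>\<rceil> else int n)"
    and "C1 \<equiv> 2 powr ((max \<alpha> \<beta>) + 1) * K / (min \<alpha> \<beta>) *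
           (1 / ((1 - exp (- 2 * sqrt (pi * d * (min \<alpha> \<beta>)))) * cos d powr (max \<alpha> \<beta>)) * sqrt (pi / (d * (min \<alpha> \<beta>)))
            + 11 / 10)"
  shows "\<forall>\<tau>::real.
           norm (integral {..\<tau>} (\<lambda>t. f (complex_of_real t))
             - (\<Sum>k\<in>{-M..N}. f (complex_of_real (sinh (real_of_int k * h)))
                  * complex_of_real (cosh (real_of_int k * h) * Jfun k h (arsinh \<tau>))))
           \<le> C1 * exp (- sqrt (pi * d * (min \<alpha> \<beta>) * real n))"
proof
  fix \<tau> :: real
  define \<mu> \<nu> where "\<mu> = min \<alpha> \<beta>" and "\<nu> = max \<alpha> \<beta>"
  define g where "g = (\<lambda>z. f (sinh z) * cosh z)"
  define \<sigma> where "\<sigma> = sqrt (pi * d * \<mu> * real n)"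
  \<comment> \<open>One constant for both half-strips:
    \<open>2 powr \<gamma> / cos d powr \<gamma>\<close> increases with \<open>\<gamma>\<close>
    because \<open>cos d \<le> 1\<close>.\<close>
  define G where "G = K * (2 powr \<nu> / cos d powr \<nu>)"
  define T where "T = 11/10 * (K * 2 powr \<alpha> * (exp (- \<alpha> * (real_of_int M * h)) / \<alpha>) + K * 2 powr \<beta> * (exp (- \<beta> * (real_of_int N * h)) / \<beta>))"
  have \<mu>: "\<mu> > 0" "\<mu> \<le> \<alpha>" "\<mu> \<le> \<beta>" and \<nu>: "\<alpha> \<le> \<nu>" "\<beta> \<le> \<nu>"
    using \<open>\<alpha> > 0\<close> \<open>\<beta> > 0\<close> by (auto simp: \<mu>_def \<nu>_def)
  note d = \<open>0 < d\<close> \<open>d < pi / 2\<close>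
  have cosd: "0 < cos d" "cos d \<le> 1" using d by (auto intro: cos_gt_zero)
  have h: "h > 0" using d \<mu> \<open>n > 0\<close> unfolding h_def \<mu>_def[symmetric] by simp
  \<comment> \<open>The choice of \<open>h\<close> balances the errors: truncation decays like
    \<open>exp (- \<mu> * n * h)\<close>, discretization like \<open>exp (- pi * d / h)\<close>, and
    both exponents equal \<open>\<sigma>\<close>.\<close>
  have h_\<sigma>: "\<mu> * real n * h = \<sigma>" "pi * d / h = \<sigma>"
  proof -
    have h2: "h\<^sup>2 = pi * d / (\<mu> * real n)"
      unfolding h_def \<mu>_def[symmetric] using d \<mu> by simp
    have "(\<mu> * real n * h)\<^sup>2 = pi * d * \<mu> * real n"
      unfolding power_mult_distrib h2 using \<mu> \<open>n > 0\<close> by (simp add: power2_eq_square)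
    thus "\<mu> * real n * h = \<sigma>"
      unfolding \<sigma>_def using h \<mu> by (intro real_sqrt_unique[symmetric]) auto
    have "h * \<sigma> = pi * d"
      unfolding \<sigma>_def h_def \<mu>_def[symmetric] real_sqrt_mult[symmetric] using d \<mu> \<open>n > 0\<close>
      by (intro real_sqrt_unique) (auto simp: power2_eq_square)
    thus "pi * d / h = \<sigma>" using h by (simp add: field_simps)
  qed
  have K: "K > 0" by fact
  have G0: "G \<ge> 0" using K by (simp add: G_def)

  have cosh_lower: "exp \<bar>Re z\<bar> / 2 * cos d \<le> norm (cosh z)" if "z \<in> strip d" for z
  proof -
    have "cos d \<le> cos (Im z)"
      using that d by (subst cos_abs_real[symmetric], intro cos_monotone_0_pi_le) (auto simp: strip_def)
    hence "exp \<bar>Re z\<bar> / 2 * cos d \<le> cosh (Re z) * cos (Im z)"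
      using cosd by (intro mult_mono exp_abs_le_cosh) auto
    thus ?thesis using cosh_times_cos_le_norm_cosh[of z] by linarith
  qed
  have cosh_nz: "cosh z \<noteq> 0" if "z \<in> strip d" for z
  proof -
    have "0 < exp \<bar>Re z\<bar> / 2 * cos d" using cosd by simp
    thus ?thesis using cosh_lower[OF that] by auto
  qed
  have g_neg: "norm (g z) \<le> K * norm (cosh z) powr (-\<alpha>)" if "z \<in> strip d" "Re z < 0" for z
    unfolding g_def using assms(7)[OF that] cosh_nz[OF that(1)] by (rule norm_times_cosh_le[rotated])
  have g_pos: "norm (g z) \<le> K * norm (cosh z) powr (-\<beta>)" if "z \<in> strip d" "Re z \<ge> 0" for z
    unfolding g_def using assms(8)[OF that] cosh_nz[OF that(1)] by (rule norm_times_cosh_le[rotated])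
  have g_bound: "norm (g z) \<le> G * exp (- \<mu> * \<bar>Re z\<bar>)" if z: "z \<in> strip d" for z
  proof -
    have le: "K * norm (cosh z) powr (-\<gamma>) \<le> G * exp (- \<mu> * \<bar>Re z\<bar>)" if \<gamma>: "\<mu> \<le> \<gamma>" "\<gamma> \<le> \<nu>" for \<gamma>
    proof -
      have "norm (cosh z) powr (-\<gamma>) \<le> 2 powr \<gamma> / cos d powr \<gamma> * exp (- \<gamma> * \<bar>Re z\<bar>)"
        using \<gamma> \<mu> cosd by (intro powr_minus_le_exp_decay cosh_lower z) auto
      also have "\<dots> \<le> 2 powr \<nu> / cos d powr \<nu> * exp (- \<mu> * \<bar>Re z\<bar>)"
        using \<gamma> \<mu> cosd by (intro mult_mono frac_le powr_mono powr_mono') (auto intro!: mult_right_mono)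
      finally show ?thesis unfolding G_def mult.assoc[of K] using K by (intro mult_left_mono) auto
    qed
    show ?thesis
      using g_neg[OF z] g_pos[OF z] le[of \<alpha>] le[of \<beta>] \<mu> \<nu> by (cases "Re z < 0") auto
  qed
  have real_strip: "complex_of_real t \<in> strip d" for t using d by (simp add: strip_def)
  have real_decay: "norm (cosh (complex_of_real t)) powr (-\<gamma>) \<le> 2 powr \<gamma> * exp (- \<gamma> * \<bar>t\<bar>)" if "\<gamma> > 0" for t \<gamma>
    using powr_minus_le_exp_decay[of 1 \<gamma> t "cosh t"] that exp_abs_le_cosh[of t] by (simp add: cosh_complex_of_real)
  have g_real_neg: "norm (g (of_real t)) \<le> K * 2 powr \<alpha> * exp (- \<alpha> * \<bar>t\<bar>)" if "t < 0" for t
  proof -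
    have "norm (g (of_real t)) \<le> K * norm (cosh (complex_of_real t)) powr (-\<alpha>)"
      using that by (intro g_neg real_strip) auto
    also have "\<dots> \<le> K * (2 powr \<alpha> * exp (- \<alpha> * \<bar>t\<bar>))"
      using K \<open>\<alpha> > 0\<close> by (intro mult_left_mono real_decay) auto
    finally show ?thesis by (simp only: mult.assoc)
  qed
  have g_real_pos: "norm (g (of_real t)) \<le> K * 2 powr \<beta> * exp (- \<beta> * \<bar>t\<bar>)" if "t \<ge> 0" for t
  proof -
    have "norm (g (of_real t)) \<le> K * norm (cosh (complex_of_real t)) powr (-\<beta>)"
      using that by (intro g_pos real_strip) auto
    also have "\<dots> \<le> K * (2 powr \<beta> * exp (- \<beta> * \<bar>t\<bar>))"
      using K \<open>\<beta> > 0\<close> by (intro mult_left_mono real_decay) auto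
    finally show ?thesis by (simp only: mult.assoc)
  qed

  have holo: "g holomorphic_on strip d"
  proof -
    have "(f \<circ> sinh) analytic_on strip d"
      by (rule analytic_on_compose[OF _ assms(3)]) (auto simp: sinh_def intro!: analytic_intros)
    hence "(\<lambda>z. f (sinh z)) holomorphic_on strip d"
      by (simp add: analytic_imp_holomorphic o_def)
    moreover have "cosh holomorphic_on strip d"
      unfolding cosh_conv_cos[abs_def] by (intro holomorphic_intros)
    ultimately show ?thesis unfolding g_def by (rule holomorphic_on_mult)
  qed
  have "(\<lambda>t. g (of_real t)) absolutely_integrable_on {..arsinh \<tau>}"
  proof (rule absolutely_integrable_exp_decay[OF \<mu>(1)])
    show "continuous_on UNIV (\<lambda>t. g (of_real t))"
      by (rule continuous_on_compose2[OF holomorphic_on_imp_continuous_on[OF holo]])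
         (use real_strip in \<open>auto intro!: continuous_intros\<close>)
    show "norm (g (of_real t)) \<le> G * exp (- \<mu> * \<bar>t\<bar>)" for t using g_bound[OF real_strip[of t]] by simp
  qed auto
  hence subst: "integral {..\<tau>} (\<lambda>t. f (of_real t)) = integral {..arsinh \<tau>} (\<lambda>t. g (of_real t))"
    unfolding g_def by (rule integral_atMost_sinh_substitution)
  define X where "X = norm (integral {..arsinh \<tau>} (\<lambda>t. g (of_real t)) -
      (\<Sum>k\<in>{-M..N}. g (of_real (real_of_int k * h)) * of_real (Jfun k h (arsinh \<tau>))))"
  have MN0: "M \<ge> 0" "N \<ge> 0"
  proof -
    have "\<beta> * real n / \<alpha> \<ge> 0" "\<alpha> * real n / \<beta> \<ge> 0" using \<open>\<alpha> > 0\<close> \<open>\<beta> > 0\<close> by auto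
    hence "\<lceil>\<beta> * real n / \<alpha>\<rceil> \<ge> 0" "\<lceil>\<alpha> * real n / \<beta>\<rceil> \<ge> 0" by linarith+
    thus "M \<ge> 0" "N \<ge> 0" unfolding M_def N_def by auto
  qed

  have step: "X \<le> 2 * G * h / (pi * \<mu> * d' * sinh (pi * d' / h)) + T" if d': "0 < d'" "d' < d" for d'
  proof -
    let ?B = "2 * G * h / (pi * \<mu> * d' * sinh (pi * d' / h))"
    obtain \<epsilon> where \<epsilon>: "\<epsilon> \<longlonglongrightarrow> 0"
      and ev: "eventually (\<lambda>m. norm (integral {..arsinh \<tau>} (\<lambda>t. g (of_real t)) -
           (\<Sum>k\<in>{-int m..int m}. g (of_real (real_of_int k * h)) * of_real (Jfun k h (arsinh \<tau>)))) \<le> ?B + \<epsilon> m) sequentially"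
      by (rule indefinite_sinc_discretization_error[OF holo d' h \<mu>(1) G0 g_bound])
    have "eventually (\<lambda>m. X \<le> ?B + \<epsilon> m + T) sequentially"
      using ev eventually_ge_at_top[of "nat M"] eventually_ge_at_top[of "nat N"]
    proof eventually_elim
      case (elim m)
      let ?S = "\<lambda>A. \<Sum>k\<in>A. g (of_real (real_of_int k * h)) * of_real (Jfun k h (arsinh \<tau>))"
      have "norm (?S {-int m..int m} - ?S {-M..N}) \<le> T"
        unfolding T_def using elim(2,3) MN0 K
        by (intro indefinite_sinc_truncation_error[OF h \<open>\<alpha> > 0\<close> \<open>\<beta> > 0\<close>] g_real_neg g_real_pos) auto
      moreover have "X \<le> norm (integral {..arsinh \<tau>} (\<lambda>t. g (of_real t)) - ?S {-int m..int m}) + norm (?S {-int m..int m} - ?S {-M..N})"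
        unfolding X_def dist_norm[symmetric] by (rule dist_triangle)
      ultimately show ?case using elim(1) by linarith
    qed
    moreover have "(\<lambda>m. ?B + \<epsilon> m + T) \<longlonglongrightarrow> ?B + 0 + T" by (intro tendsto_intros \<epsilon>)
    ultimately have "X \<le> ?B + 0 + T" by (intro tendsto_lowerbound[of _ _ sequentially]) auto
    thus ?thesis by simp
  qed
  have X_le: "X \<le> 2 * G * h / (pi * \<mu> * d * sinh \<sigma>) + T"
  proof -
    have "((\<lambda>d'. 2 * G * h / (pi * \<mu> * d' * sinh (pi * d' / h)) + T) \<longlongrightarrow>
            2 * G * h / (pi * \<mu> * d * sinh (pi * d / h)) + T) (at_left d)"
      using d \<mu> h by (intro tendsto_intros) auto
    moreover have "eventually (\<lambda>d'. X \<le> 2 * G * h / (pi * \<mu> * d' * sinh (pi * d' / h)) + T) (at_left d)"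
      using step d by (auto simp: eventually_at_left)
    ultimately have "X \<le> 2 * G * h / (pi * \<mu> * d * sinh (pi * d / h)) + T"
      by (intro tendsto_lowerbound) auto
    thus ?thesis by (simp only: h_\<sigma>)
  qed

  have trunc: "T \<le> 2 powr (\<nu> + 1) * K / \<mu> * (11/10) * exp (- \<sigma>)"
  proof -
    \<comment> \<open>The ceilings give the side with the faster decay no more terms than the other,
      while both exponents stay at least \<open>\<mu> * n\<close>.\<close>
    have "\<alpha> * real_of_int M \<ge> \<mu> * real n" "\<beta> * real_of_int N \<ge> \<mu> * real n"
    proof -
      have "\<alpha> * real_of_int \<lceil>\<beta> * real n / \<alpha>\<rceil> \<ge> \<alpha> * (\<beta> * real n / \<alpha>)"
        "\<beta> * real_of_int \<lceil>\<alpha> * real n / \<beta>\<rceil> \<ge> \<beta> * (\<alpha> * real n / \<beta>)"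
        using \<open>\<alpha> > 0\<close> \<open>\<beta> > 0\<close> by (intro mult_left_mono le_of_int_ceiling; simp)+
      thus "\<alpha> * real_of_int M \<ge> \<mu> * real n" "\<beta> * real_of_int N \<ge> \<mu> * real n"
        using \<open>\<alpha> > 0\<close> \<open>\<beta> > 0\<close> by (auto simp: M_def N_def \<mu>_def min_def split: if_splits)
    qed
    hence ex: "\<alpha> * (real_of_int M * h) \<ge> \<sigma>" "\<beta> * (real_of_int N * h) \<ge> \<sigma>"
      unfolding h_\<sigma>(1)[symmetric] using h by (auto simp flip: mult.assoc intro!: mult_right_mono)
    have part: "K * 2 powr \<gamma> * (exp (- \<gamma> * y) / \<gamma>) \<le> K * 2 powr \<nu> * (exp (- \<sigma>) / \<mu>)"
      if "\<mu> \<le> \<gamma>" "\<gamma> \<le> \<nu>" "\<gamma> * y \<ge> \<sigma>" for \<gamma> y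
      using that \<mu>(1) K by (intro mult_mono frac_le) auto
    \<comment> \<open>Both tails receive the same worst-case bound; their number accounts for the
      extra 2 in \<open>2 powr (\<nu> + 1)\<close>.\<close>
    have "T \<le> 11/10 * (K * 2 powr \<nu> * (exp (- \<sigma>) / \<mu>) + K * 2 powr \<nu> * (exp (- \<sigma>) / \<mu>))"
      unfolding T_def using \<mu> \<nu> ex by (intro mult_left_mono add_mono part) auto
    also have "\<dots> = 2 powr (\<nu> + 1) * K / \<mu> * (11/10) * exp (- \<sigma>)"
      by (simp add: powr_add)
    finally show ?thesis .
  qed
  have disc: "2 * G * h / (pi * \<mu> * d * sinh \<sigma>) \<le> 2 powr (\<nu> + 1) * K / \<mu> *
      (1 / ((1 - exp (- 2 * sqrt (pi * d * \<mu>))) * cos d powr \<nu>) * sqrt (pi / (d * \<mu>))) * exp (- \<sigma>)"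
  proof -
    define s0 where "s0 = sqrt (pi * d * \<mu>)"
    have s0: "s0 > 0" using d \<mu> by (simp add: s0_def)
    have "real n \<ge> 1" using \<open>n > 0\<close> by simp
    hence "pi * d * \<mu> * 1 \<le> pi * d * \<mu> * real n" using d \<mu> by (intro mult_left_mono) auto
    hence s0_le: "s0 \<le> \<sigma>" by (simp add: s0_def \<sigma>_def)
    \<comment> \<open>\<open>n \<ge> 1\<close> gives \<open>s0 \<le> \<sigma>\<close>, which removes
      \<open>n\<close> from the denominator. In this part the extra 2 in
      \<open>2 powr (\<nu> + 1)\<close> comes from \<open>sinh\<close>.\<close>
    have inv_sinh: "1 / sinh \<sigma> \<le> 2 * exp (- \<sigma>) / (1 - exp (- 2 * s0))"
    proof -
      have "sinh \<sigma> = (1 - exp (- 2 * \<sigma>)) / (2 * exp (- \<sigma>))"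
        using exp_double[of "- \<sigma>"] by (simp add: sinh_def exp_minus field_simps power2_eq_square)
      hence "1 / sinh \<sigma> = 2 * exp (- \<sigma>) / (1 - exp (- 2 * \<sigma>))" by simp
      also have "\<dots> \<le> 2 * exp (- \<sigma>) / (1 - exp (- 2 * s0))"
        using s0 s0_le by (intro divide_left_mono mult_pos_pos) auto
      finally show ?thesis .
    qed
    have h_le: "2 * h / (pi * d) \<le> sqrt (pi / (d * \<mu>))"
    proof -
      have "h \<le> sqrt (pi * d / \<mu>)"
        unfolding h_def \<mu>_def[symmetric] using d \<mu> \<open>real n \<ge> 1\<close>
        by (intro real_sqrt_le_mono divide_left_mono) auto
      also have "\<dots> = d * sqrt (pi / (d * \<mu>))"
      proof (rule real_sqrt_unique)
        have "(d * sqrt (pi / (d * \<mu>)))\<^sup>2 = d\<^sup>2 * (pi / (d * \<mu>))"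
          using d \<mu> by (simp add: power_mult_distrib)
        also have "\<dots> = pi * d / \<mu>" using d by (simp add: power2_eq_square)
        finally show "(d * sqrt (pi / (d * \<mu>)))\<^sup>2 = pi * d / \<mu>" .
      qed (use d \<mu> in auto)
      finally have "h / d \<le> sqrt (pi / (d * \<mu>))" using d by (simp add: field_simps)
      \<comment> \<open>Only the factor \<open>2 / pi\<close> is to spare here. A kernel bound with
        \<open>pi + 2\<close> in place of \<open>pi\<close> would require
        \<open>2 * (pi + 2) \<le> pi\<^sup>2\<close>, which is false.\<close>
      moreover have "2 * h / (pi * d) \<le> h / d"
        using pi_gt3 h d by (simp add: field_simps)
      ultimately show ?thesis by linarith
    qed
    have "2 * G * h / (pi * \<mu> * d * sinh \<sigma>) = G / \<mu> * (2 * h / (pi * d)) * (1 / sinh \<sigma>)" by (simp add: mult_ac)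
    also have "\<dots> \<le> G / \<mu> * sqrt (pi / (d * \<mu>)) * (2 * exp (- \<sigma>) / (1 - exp (- 2 * s0)))"
      using G0 \<mu>(1) d s0 s0_le by (intro mult_mono mult_left_mono h_le inv_sinh) auto
    also have "\<dots> = 2 powr (\<nu> + 1) * K / \<mu> *
      (1 / ((1 - exp (- 2 * s0)) * cos d powr \<nu>) * sqrt (pi / (d * \<mu>))) * exp (- \<sigma>)"
      by (simp add: G_def powr_add mult_ac)
    finally show ?thesis by (simp only: s0_def)
  qed
  have "X \<le> C1 * exp (- \<sigma>)"
    using add_mono[OF disc trunc] X_le
    unfolding C1_def \<mu>_def[symmetric] \<nu>_def[symmetric] distrib_left distrib_right by linarith
  moreover have "(\<Sum>k\<in>{-M..N}. f (of_real (sinh (real_of_int k * h))) * of_real (cosh (real_of_int k * h) * Jfun k h (arsinh \<tau>)))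
      = (\<Sum>k\<in>{-M..N}. g (of_real (real_of_int k * h)) * of_real (Jfun k h (arsinh \<tau>)))"
    unfolding g_def sinh_complex_of_real cosh_complex_of_real by (simp only: of_real_mult mult.assoc)
  ultimately show "norm (integral {..\<tau>} (\<lambda>t. f (of_real t)) -
      (\<Sum>k\<in>{-M..N}. f (of_real (sinh (real_of_int k * h))) * of_real (cosh (real_of_int k * h) * Jfun k h (arsinh \<tau>))))
      \<le> C1 * exp (- sqrt (pi * d * min \<alpha> \<beta> * real n))"
    unfolding subst X_def \<sigma>_def \<mu>_def by simp
qed

end
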